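(* Let $E$ be a complex Banach space, $U$ an open subset of $E$, and $F$ a reflexive complex Banach space. If $f\in\mathcal{D}_2^{\mathcal{H}^\infty}(U,F)$, then there exist a Hilbert space $H$, an operator $T\in\mathcal{D}_2(H,F)$ and a mapping $g\in\mathcal{H}^\infty(U,H)$ such that $f=T\circ g$.
   Context: $\mathcal{H}^\infty(U,G)$ is the Banach space of bounded holomorphic mappings $U\to G$ with the supremum norm. $B_X$ is the closed unit ball of $X$. $\mathcal{D}_2^{\mathcal{H}^\infty}(U,F)$ (Cohen strongly $2$-summing holomorphic mappings) is the set of holomorphic $f\colon U\to F$ for which there is $C\geq0$ such that for all $n\in\mathbb{N}$, $\lambda_i\in\mathbb{C}$, $x_i\in U$, $y_i^*\in F^*$ ($1\le i\le n$), $\sum_{i=1}^n|\lambda_i||\langle y_i^*,f(x_i)\rangle|\leq C(\sum_i|\lambda_i|^2)^{1/2}\sup_{y^{**}\in B_{F^{**}}}(\sum_i|y^{**}(y_i^* )|^2)^{1/2}$. $\mathcal{D}_2(X,F)$ (strongly $2$-summing operators), for Banach spaces $X,F$, is the set of bounded linear $T\colon X\to F$ for which there is $C\geq0$ such that for all $n\in\mathbb{N}$, $x_i\in X$, $y_i^*\in F^*$, $\sum_{i=1}^n|\langle y_i^*,T(x_i)\rangle|\leq C(\sum_i\|x_i\|^2)^{1/2}\sup_{y^{**}\in B_{F^{**}}}(\sum_i|y^{**}(y_i^* )|^2)^{1/2}$. *)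

theory Defs
  imports "HOL-Analysis.Analysis" "HOL-Algebra.Module"
begin

section \<open>Complex normed spaces, duals and reflexivity\<close>

class complex_normed_vector = real_normed_vector +
  fixes scaleC :: "complex \<Rightarrow> 'a \<Rightarrow> 'a" (infixr "*\<^sub>C" 75)
  assumes scaleC_add_right: "c *\<^sub>C (x + y) = c *\<^sub>C x + c *\<^sub>C y"
    and scaleC_add_left: "(c + d) *\<^sub>C x = c *\<^sub>C x + d *\<^sub>C x"
    and scaleC_scaleC: "c *\<^sub>C d *\<^sub>C x = (c * d) *\<^sub>C x"
    and scaleR_scaleC: "r *\<^sub>R x = complex_of_real r *\<^sub>C x"
    and norm_scaleC: "norm (c *\<^sub>C x) = cmod c * norm x"

class complex_banach = complex_normed_vector + banach

text \<open>The topological dual with the operator norm: the complex-linear elements of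
  \<^typ>\<open>'a::real_normed_vector \<Rightarrow>\<^sub>L complex\<close>, whose norm is inherited.\<close>

typedef (overloaded) 'a cdual =
  "{\<phi> :: 'a::complex_normed_vector \<Rightarrow>\<^sub>L complex. \<forall>c x. blinfun_apply \<phi> (c *\<^sub>C x) = c * blinfun_apply \<phi> x}"
  morphisms blinfun_of_cdual Abs_cdual
  by (rule exI[of _ 0]) simp

setup_lifting type_definition_cdual

lift_definition cdual_apply :: "'a::complex_normed_vector cdual \<Rightarrow> 'a \<Rightarrow> complex"
  is blinfun_apply .

instantiation cdual :: (complex_normed_vector) complex_normed_vector
begin

lift_definition zero_cdual :: "'a cdual" is 0 by simp
lift_definition plus_cdual :: "'a cdual \<Rightarrow> 'a cdual \<Rightarrow> 'a cdual" is "(+)"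
  by (simp add: blinfun.add_left algebra_simps)
lift_definition minus_cdual :: "'a cdual \<Rightarrow> 'a cdual \<Rightarrow> 'a cdual" is "(-)"
  by (simp add: blinfun.diff_left algebra_simps)
lift_definition uminus_cdual :: "'a cdual \<Rightarrow> 'a cdual" is "uminus"
  by (simp add: blinfun.minus_left)
lift_definition scaleR_cdual :: "real \<Rightarrow> 'a cdual \<Rightarrow> 'a cdual" is "scaleR"
  by (simp add: blinfun.scaleR_left)
lift_definition scaleC_cdual :: "complex \<Rightarrow> 'a cdual \<Rightarrow> 'a cdual"
  is "\<lambda>c \<phi>. blinfun_compose (Blinfun ((*) c)) \<phi>"
  by (simp add: bounded_linear_Blinfun_apply bounded_linear_mult_right)
lift_definition norm_cdual :: "'a cdual \<Rightarrow> real" is norm .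
definition sgn_cdual :: "'a cdual \<Rightarrow> 'a cdual" where
  "sgn_cdual \<phi> = inverse (norm \<phi>) *\<^sub>R \<phi>"
definition dist_cdual :: "'a cdual \<Rightarrow> 'a cdual \<Rightarrow> real" where
  "dist_cdual \<phi> \<psi> = norm (\<phi> - \<psi>)"
definition uniformity_cdual :: "('a cdual \<times> 'a cdual) filter" where
  "uniformity_cdual = (INF e\<in>{0 <..}. principal {(x, y). dist x y < e})"
definition open_cdual :: "'a cdual set \<Rightarrow> bool" where
  "open_cdual S = (\<forall>x\<in>S. \<forall>\<^sub>F (x', y) in uniformity. x' = x \<longrightarrow> y \<in> S)"

instance
proof
  fix \<phi> \<psi> \<theta> :: "'a cdual" and a b :: real and c d :: complex and S :: "'a cdual set"
  show "\<phi> + \<psi> + \<theta> = \<phi> + (\<psi> + \<theta>)" "\<phi> + \<psi> = \<psi> + \<phi>" "0 + \<phi> = \<phi>" "- \<phi> + \<phi> = 0" "\<phi> - \<psi> = \<phi> + - \<psi>"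
    by (transfer; simp)+
  show "a *\<^sub>R (\<phi> + \<psi>) = a *\<^sub>R \<phi> + a *\<^sub>R \<psi>" "(a + b) *\<^sub>R \<phi> = a *\<^sub>R \<phi> + b *\<^sub>R \<phi>"
    "a *\<^sub>R b *\<^sub>R \<phi> = (a * b) *\<^sub>R \<phi>" "1 *\<^sub>R \<phi> = \<phi>"
    by (transfer; simp add: algebra_simps)+
  show "dist \<phi> \<psi> = norm (\<phi> - \<psi>)" by (rule dist_cdual_def)
  show "sgn \<phi> = inverse (norm \<phi>) *\<^sub>R \<phi>" by (rule sgn_cdual_def)
  show "uniformity = (INF e\<in>{0 <..}. principal {(x :: 'a cdual, y). dist x y < e})"
    by (rule uniformity_cdual_def)
  show "open S = (\<forall>x\<in>S. \<forall>\<^sub>F (x', y) in uniformity. x' = x \<longrightarrow> y \<in> S)"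
    by (rule open_cdual_def)
  show "(norm \<phi> = 0) = (\<phi> = 0)" by transfer simp
  show "norm (\<phi> + \<psi>) \<le> norm \<phi> + norm \<psi>" by transfer (rule norm_triangle_ineq)
  show "norm (a *\<^sub>R \<phi>) = \<bar>a\<bar> * norm \<phi>" by transfer simp
  have ap: "blinfun_apply (Blinfun ((*) c)) z = c * z" for c z :: complex
    by (simp add: bounded_linear_Blinfun_apply bounded_linear_mult_right)
  show "c *\<^sub>C (\<phi> + \<psi>) = c *\<^sub>C \<phi> + c *\<^sub>C \<psi>" "(c + d) *\<^sub>C \<phi> = c *\<^sub>C \<phi> + d *\<^sub>C \<phi>"
    "c *\<^sub>C d *\<^sub>C \<phi> = (c * d) *\<^sub>C \<phi>"
    by (transfer, rule blinfun_eqI, simp add: ap blinfun.add_left algebra_simps)+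
  show "a *\<^sub>R \<phi> = complex_of_real a *\<^sub>C \<phi>"
    by (transfer, rule blinfun_eqI, simp add: ap blinfun.scaleR_left scaleR_conv_of_real)
  show "norm (c *\<^sub>C \<phi>) = cmod c * norm \<phi>"
  proof transfer
    fix c :: complex and f :: "'a \<Rightarrow>\<^sub>L complex"
    show "norm (blinfun_compose (Blinfun ((*) c)) f) = cmod c * norm f"
    proof (cases "c = 0")
      case True
      have "blinfun_compose (Blinfun ((*) 0)) f = 0"
        by (rule blinfun_eqI) (simp add: ap)
      with True show ?thesis by simp
    next
      case False
      have le: "norm (blinfun_compose (Blinfun ((*) d)) g) \<le> cmod d * norm g"
        for d and g :: "'a \<Rightarrow>\<^sub>L complex"
        by (rule norm_blinfun_bound)
          (auto simp: ap norm_mult mult.assoc intro!: mult_left_mono norm_blinfun)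
      let ?g = "blinfun_compose (Blinfun ((*) c)) f"
      have "blinfun_compose (Blinfun ((*) (inverse c))) ?g = f"
        using False by (intro blinfun_eqI) (simp add: ap)
      with le[of "inverse c" ?g] have "norm f \<le> inverse (cmod c) * norm ?g"
        by (simp add: norm_inverse)
      then have "cmod c * norm f \<le> norm ?g"
        using False by (simp add: field_simps)
      with le[of c f] show ?thesis by simp
    qed
  qed
qed

end

lemma cdual_apply_scaleC_left: "cdual_apply (c *\<^sub>C \<phi>) x = c * cdual_apply \<phi> x"
  by transfer (simp add: bounded_linear_Blinfun_apply bounded_linear_mult_right)

lemma cdual_apply_add_left: "cdual_apply (\<phi> + \<psi>) x = cdual_apply \<phi> x + cdual_apply \<psi> x"
  by transfer (simp add: blinfun.add_left)

lemma norm_cdual_apply: "cmod (cdual_apply \<phi> x) \<le> norm \<phi> * norm x"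
  by transfer (rule norm_blinfun)

definition canonical_embedding :: "'a::complex_normed_vector \<Rightarrow> 'a cdual cdual" where
  "canonical_embedding x = Abs_cdual (Blinfun (\<lambda>\<phi>. cdual_apply \<phi> x))"

lemma canonical_embedding_apply: "cdual_apply (canonical_embedding x) \<phi> = cdual_apply \<phi> x"
proof -
  have "bounded_linear (\<lambda>\<phi> :: 'a cdual. cdual_apply \<phi> x)"
    by (rule bounded_linear_intro[where K = "norm x"])
      (simp_all add: cdual_apply_add_left cdual_apply_scaleC_left scaleR_scaleC[where 'a = "'a cdual"]
        norm_cdual_apply scaleR_conv_of_real)
  then show ?thesis
    by (simp add: cdual_apply.rep_eq[where 'a = "'a cdual"] canonical_embedding_def Abs_cdual_inverse
        bounded_linear_Blinfun_apply cdual_apply_scaleC_left)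
qed

definition reflexive_space :: "'a::complex_normed_vector itself \<Rightarrow> bool" where
  "reflexive_space _ \<longleftrightarrow> surj (canonical_embedding :: 'a \<Rightarrow> 'a cdual cdual)"


section \<open>Complex normed spaces with explicit carrier\<close>

text \<open>HOL has no quantification over types, so a space whose existence is asserted has to be
  an explicit structure on a subset of some type, with operations, norm and inner product of its
  own. For the Hilbert space through which a mapping into a reflexive space \<open>F\<close> factors as
  \<open>T \<circ> g\<close>, the type of \<open>F\<close> is a large enough universe: replacing \<open>H\<close> by the orthogonal complement
  of the kernel of \<open>T\<close> makes \<open>T\<close> injective, and the structure can be transported along \<open>T\<close>. The fields \<open>mult\<close> and \<open>one\<close> that HOL-Algebra's module records inherit
  from rings have no meaning here.\<close>

definition complex_ring :: "complex ring" where
  "complex_ring = \<lparr>carrier = UNIV, mult = (*), one = 1, zero = 0, add = (+)\<rparr>"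

record 'a cnormed_space = "(complex, 'a) module" +
  nrm :: "'a \<Rightarrow> real"

record 'a cinner_space = "'a cnormed_space" +
  cinner :: "'a \<Rightarrow> 'a \<Rightarrow> complex"

locale complex_normed_space = Module.module complex_ring X for X (structure) +
  assumes nrm_nonneg: "x \<in> carrier X \<Longrightarrow> 0 \<le> nrm X x"
    and nrm_eq_0: "x \<in> carrier X \<Longrightarrow> nrm X x = 0 \<longleftrightarrow> x = \<zero>"
    and nrm_smult: "x \<in> carrier X \<Longrightarrow> nrm X (c \<odot> x) = cmod c * nrm X x"
    and nrm_triangle: "x \<in> carrier X \<Longrightarrow> y \<in> carrier X \<Longrightarrow> nrm X (x \<oplus> y) \<le> nrm X x + nrm X y"

locale complex_banach_space = complex_normed_space +
  assumes complete: "\<And>s :: nat \<Rightarrow> 'a. (\<And>n. s n \<in> carrier X) \<Longrightarrow>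
      (\<And>e. e > 0 \<Longrightarrow> \<exists>N. \<forall>m\<ge>N. \<forall>n\<ge>N. nrm X (s m \<ominus> s n) < e) \<Longrightarrow>
      \<exists>l\<in>carrier X. (\<lambda>n. nrm X (s n \<ominus> l)) \<longlonglongrightarrow> 0"

locale complex_hilbert_space = complex_banach_space H for H (structure) +
  assumes cinner_add: "x \<in> carrier H \<Longrightarrow> y \<in> carrier H \<Longrightarrow> z \<in> carrier H \<Longrightarrow>
      cinner H (x \<oplus> y) z = cinner H x z + cinner H y z"
    and cinner_smult: "x \<in> carrier H \<Longrightarrow> y \<in> carrier H \<Longrightarrow> cinner H (c \<odot> x) y = c * cinner H x y"
    and cinner_commute: "x \<in> carrier H \<Longrightarrow> y \<in> carrier H \<Longrightarrow> cinner H x y = cnj (cinner H y x)"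
    and cinner_self: "x \<in> carrier H \<Longrightarrow> cinner H x x = complex_of_real ((nrm H x)\<^sup>2)"

text \<open>A normed space given by a type, viewed as an explicit structure.\<close>

definition univ_space :: "'a::complex_normed_vector cnormed_space" where
  "univ_space = \<lparr>carrier = UNIV, mult = undefined, one = undefined, zero = 0, add = (+),
    smult = scaleC, nrm = norm\<rparr>"

lemma univ_space_simps [simp]:
  "carrier univ_space = UNIV" "\<zero>\<^bsub>univ_space\<^esub> = 0" "x \<oplus>\<^bsub>univ_space\<^esub> y = x + y"
  "c \<odot>\<^bsub>univ_space\<^esub> x = c *\<^sub>C x" "nrm univ_space x = norm x"
  by (simp_all add: univ_space_def)

lemma complex_normed_space_univ_space:
  "complex_normed_space (univ_space :: 'a::complex_normed_vector cnormed_space)"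
proof -
  have inv: "\<exists>y. x + y = 0" for x :: complex by (rule exI[of _ "- x"]) simp
  have inv': "\<exists>y. x + y = 0" for x :: 'a by (rule exI[of _ "- x"]) simp
  have one: "1 *\<^sub>C x = x" for x :: 'a
    using scaleR_scaleC[of 1 x] by simp
  have cr: "cring complex_ring"
    by (rule cringI; (rule abelian_groupI comm_monoidI)?)
      (auto simp: complex_ring_def algebra_simps inv)
  have ag: "abelian_group (univ_space :: 'a cnormed_space)"
    by (rule abelian_groupI) (auto simp: algebra_simps inv')
  have "Module.module complex_ring (univ_space :: 'a cnormed_space)"
    by (rule moduleI[OF cr ag])
      (auto simp: complex_ring_def scaleC_add_left scaleC_add_right scaleC_scaleC one)
  then show ?thesis
    by (rule complex_normed_space.intro, unfold_locales)
      (auto simp: norm_scaleC norm_triangle_ineq)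
qed

lemma a_minus_univ_space [simp]: "x \<ominus>\<^bsub>univ_space\<^esub> y = x - y"
proof -
  interpret complex_normed_space "univ_space :: 'a cnormed_space"
    by (rule complex_normed_space_univ_space)
  have "\<ominus>\<^bsub>univ_space\<^esub> y = - y"
    by (rule minus_equality) auto
  then show ?thesis by (simp add: a_minus_def)
qed

lemma complex_banach_space_univ_space:
  "complex_banach_space (univ_space :: 'a::complex_banach cnormed_space)"
proof (rule complex_banach_space.intro[OF complex_normed_space_univ_space], unfold_locales)
  fix s :: "nat \<Rightarrow> 'a"
  assume "\<And>e. e > 0 \<Longrightarrow> \<exists>N. \<forall>m\<ge>N. \<forall>n\<ge>N. nrm univ_space (s m \<ominus>\<^bsub>univ_space\<^esub> s n) < e"
  then have "Cauchy s" by (simp add: Cauchy_def dist_norm)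
  then obtain l where "s \<longlonglongrightarrow> l" using Cauchy_convergent convergent_def by blast
  then have "(\<lambda>n. norm (s n - l)) \<longlonglongrightarrow> 0"
    using Lim_null tendsto_norm_zero by blast
  then show "\<exists>l\<in>carrier univ_space. (\<lambda>n. nrm univ_space (s n \<ominus>\<^bsub>univ_space\<^esub> l)) \<longlonglongrightarrow> 0"
    by auto
qed


section \<open>Operators and holomorphic mappings\<close>

definition bounded_operators ::
  "('a, 'm) cnormed_space_scheme \<Rightarrow> ('b, 'n) cnormed_space_scheme \<Rightarrow> ('a \<Rightarrow> 'b) set" where
  "bounded_operators X Y = {T.
     (\<forall>x\<in>carrier X. T x \<in> carrier Y) \<and>
     (\<forall>x\<in>carrier X. \<forall>y\<in>carrier X. T (x \<oplus>\<^bsub>X\<^esub> y) = T x \<oplus>\<^bsub>Y\<^esub> T y) \<and>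
     (\<forall>c. \<forall>x\<in>carrier X. T (c \<odot>\<^bsub>X\<^esub> x) = c \<odot>\<^bsub>Y\<^esub> T x) \<and>
     (\<exists>K. \<forall>x\<in>carrier X. nrm Y (T x) \<le> K * nrm X x)}"

text \<open>Holomorphic means complex Frechet differentiable at every point of \<open>U\<close>. Since a mapping
  is represented by a total function, its values outside \<open>U\<close> are irrelevant.\<close>

definition holomorphic_maps ::
  "'e::complex_normed_vector set \<Rightarrow> ('g, 'n) cnormed_space_scheme \<Rightarrow> ('e \<Rightarrow> 'g) set" where
  "holomorphic_maps U G = {g.
     (\<forall>x\<in>U. g x \<in> carrier G) \<and>
     (\<forall>x\<in>U. \<exists>D\<in>bounded_operators univ_space G.
        ((\<lambda>y. nrm G ((g y \<ominus>\<^bsub>G\<^esub> g x) \<ominus>\<^bsub>G\<^esub> D (y - x)) / norm (y - x)) \<longlongrightarrow> 0) (at x within U))}"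

definition bounded_holomorphic_maps ::
  "'e::complex_normed_vector set \<Rightarrow> ('g, 'n) cnormed_space_scheme \<Rightarrow> ('e \<Rightarrow> 'g) set" where
  "bounded_holomorphic_maps U G = {g \<in> holomorphic_maps U G. \<exists>M. \<forall>x\<in>U. nrm G (g x) \<le> M}"

lemma holomorphic_maps_univ_space_iff:
  fixes f :: "'e::complex_normed_vector \<Rightarrow> 'f::complex_normed_vector"
  assumes "open U"
  shows "f \<in> holomorphic_maps U univ_space \<longleftrightarrow>
    (\<forall>x\<in>U. \<exists>D. (f has_derivative D) (at x) \<and> (\<forall>c h. D (c *\<^sub>C h) = c *\<^sub>C D h))"
proof -
  have op: "D \<in> bounded_operators univ_space univ_space \<longleftrightarrow>
      bounded_linear D \<and> (\<forall>c h. D (c *\<^sub>C h) = c *\<^sub>C D h)" for D :: "'e \<Rightarrow> 'f"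
  proof
    assume "D \<in> bounded_operators univ_space univ_space"
    then obtain K where "\<And>x y. D (x + y) = D x + D y" "\<And>c x. D (c *\<^sub>C x) = c *\<^sub>C D x"
      "\<And>x. norm (D x) \<le> K * norm x"
      by (auto simp: bounded_operators_def)
    then show "bounded_linear D \<and> (\<forall>c h. D (c *\<^sub>C h) = c *\<^sub>C D h)"
      by (auto intro!: bounded_linear_intro[where K = K] simp: scaleR_scaleC mult.commute)
  next
    assume D: "bounded_linear D \<and> (\<forall>c h. D (c *\<^sub>C h) = c *\<^sub>C D h)"
    then obtain K where "\<And>x. norm (D x) \<le> norm x * K"
      using bounded_linear.bounded by blast
    then have "\<exists>K. \<forall>x. norm (D x) \<le> K * norm x"
      by (metis mult.commute)
    with D show "D \<in> bounded_operators univ_space univ_space"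
      by (simp add: bounded_operators_def linear_add bounded_linear.linear)
  qed
  have der: "((\<lambda>y. norm (f y - f x - D (y - x)) / norm (y - x)) \<longlongrightarrow> 0) (at x within U)
      \<longleftrightarrow> (f has_derivative D) (at x)" if "x \<in> U" "bounded_linear D" for x and D :: "'e \<Rightarrow> 'f"
    unfolding at_within_open[OF that(1) assms] has_derivative_iff_norm using that(2) by simp
  show ?thesis
  proof -
    have "(\<exists>D\<in>bounded_operators univ_space univ_space.
          ((\<lambda>y. norm (f y - f x - D (y - x)) / norm (y - x)) \<longlongrightarrow> 0) (at x within U)) \<longleftrightarrow>
        (\<exists>D. (f has_derivative D) (at x) \<and> (\<forall>c h. D (c *\<^sub>C h) = c *\<^sub>C D h))"
      if "x \<in> U" for x
      unfolding Bex_def op using der[OF that] has_derivative_bounded_linear by blast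
    then show ?thesis
      by (simp add: holomorphic_maps_def)
  qed
qed


section \<open>Strongly summing mappings\<close>

text \<open>\<^term>\<open>cball (0 :: 'f::complex_normed_vector cdual cdual) 1\<close> is the closed unit ball of the
  bidual. The set is bounded above by the lemma below, so \<open>SUP\<close> is a genuine supremum.\<close>

definition weak_l2_norm :: "nat \<Rightarrow> (nat \<Rightarrow> 'f::complex_normed_vector cdual) \<Rightarrow> real" where
  "weak_l2_norm n ys = (SUP \<eta> \<in> cball (0 :: 'f cdual cdual) 1.
     sqrt (\<Sum>i=1..n. (cmod (cdual_apply \<eta> (ys i)))\<^sup>2))"

lemma weak_l2_norm_bdd_above:
  "bdd_above ((\<lambda>\<eta>. sqrt (\<Sum>i=1..n. (cmod (cdual_apply \<eta> (ys i)))\<^sup>2))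
     ` cball (0 :: 'f::complex_normed_vector cdual cdual) 1)"
proof (rule bdd_aboveI2)
  fix \<eta> :: "'f cdual cdual"
  assume \<eta>: "\<eta> \<in> cball 0 1"
  have "cmod (cdual_apply \<eta> (ys i)) \<le> norm (ys i)" for i
    using norm_cdual_apply[of \<eta> "ys i"] \<eta> mult_right_mono[of "norm \<eta>" 1 "norm (ys i)"] by simp
  then show "sqrt (\<Sum>i=1..n. (cmod (cdual_apply \<eta> (ys i)))\<^sup>2) \<le> sqrt (\<Sum>i=1..n. (norm (ys i))\<^sup>2)"
    by (intro real_sqrt_le_mono sum_mono power_mono) simp_all
qed

definition strongly_2_summing_operators ::
  "('x, 'm) cnormed_space_scheme \<Rightarrow> ('x \<Rightarrow> 'f::complex_normed_vector) set" where
  "strongly_2_summing_operators X = {T \<in> bounded_operators X univ_space. \<exists>C\<ge>0.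
     \<forall>n (x :: nat \<Rightarrow> 'x) (ys :: nat \<Rightarrow> 'f cdual). (\<forall>i\<in>{1..n}. x i \<in> carrier X) \<longrightarrow>
       (\<Sum>i=1..n. cmod (cdual_apply (ys i) (T (x i))))
         \<le> C * sqrt (\<Sum>i=1..n. (nrm X (x i))\<^sup>2) * weak_l2_norm n ys}"

definition cohen_strongly_2_summing_holomorphic_maps ::
  "'e::complex_normed_vector set \<Rightarrow> ('e \<Rightarrow> 'f::complex_normed_vector) set" where
  "cohen_strongly_2_summing_holomorphic_maps U = {f \<in> holomorphic_maps U univ_space. \<exists>C\<ge>0.
     \<forall>n (a :: nat \<Rightarrow> complex) (x :: nat \<Rightarrow> 'e) (ys :: nat \<Rightarrow> 'f cdual). (\<forall>i\<in>{1..n}. x i \<in> U) \<longrightarrow>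
       (\<Sum>i=1..n. cmod (a i) * cmod (cdual_apply (ys i) (f (x i))))
         \<le> C * sqrt (\<Sum>i=1..n. (cmod (a i))\<^sup>2) * weak_l2_norm n ys}"

end

theory Submission
  imports Defs "HOL-Complex_Analysis.Cauchy_Integral_Formula"
begin

text \<open>
  The Hilbert space is found inside \<open>F\<close>: it is a subspace with a stronger, Hilbertian norm, so that
  \<open>T\<close> is the inclusion and \<open>g\<close> is \<open>f\<close> itself.

  The summing inequality is a domination statement in disguise. Classically it gives a
  probability measure \<open>\<mu>\<close> on the unit ball of \<open>F\<^sup>*\<^sup>*\<close> with
  \<open>|y(f x)|\<^sup>2 \<le> C\<^sup>2 \<integral> |\<eta>(y)|\<^sup>2 d\<mu>(\<eta>)\<close> for all \<open>x \<in> U\<close> and \<open>y \<in> F\<^sup>*\<close>. Only the quadratic form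
  \<open>y \<mapsto> \<integral> |\<eta>(y)|\<^sup>2 d\<mu>(\<eta>)\<close> matters, so measures are avoided: \<open>dominated_forms\<close> is the set of
  positive Hermitian forms \<open>s\<close> on \<open>F\<^sup>*\<close> with \<open>\<Sum> s(y\<^sub>i, y\<^sub>i) \<le> w\<^sup>2\<close>, where \<open>w\<close> is the weak \<open>l\<^sub>2\<close> norm
  of the family \<open>(y\<^sub>i)\<close>. This set is convex, it is compact for pointwise convergence by Tychonoff's
  theorem, and it contains the rank one forms given by the unit ball of \<open>F\<^sup>*\<^sup>*\<close>. A minimax
  argument then yields \<open>s\<close> with \<open>|y(f x)|\<^sup>2 \<le> C\<^sup>2 s(y, y)\<close>; this is \<open>Pietsch_domination_by_form\<close>.

  Let \<open>q(y)\<close> (the constant \<open>form_norm\<close>) be the square root of \<open>s(y, y)\<close>. The Hilbert space consists of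
  those \<open>h \<in> F\<close> for which \<open>y \<mapsto> y(h)\<close> is bounded with respect to \<open>q\<close>, normed by the least bound. It is a part of the dual of
  the pre-Hilbert space \<open>(F\<^sup>*, q)\<close>, and its inner product comes from approximate Riesz
  representers (\<open>approximate_Riesz\<close>). By the Hahn-Banach theorem its norm dominates half the norm
  of \<open>F\<close>, so Cauchy sequences have limits in \<open>F\<close>, and these inherit the bounds. The inclusion into
  \<open>F\<close> is strongly 2-summing by the Cauchy-Schwarz inequality and the defining inequality of
  \<open>dominated_forms\<close>. The domination says exactly that \<open>f\<close> takes values in the ball of radius \<open>C\<close> of
  this space. Finally \<open>f\<close> is holomorphic for the stronger norm: the Cauchy estimates for the scalar
  functions \<open>y \<circ> f\<close> carry the factor \<open>q(y)\<close>, so they are estimates in that norm.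
\<close>

section \<open>Almost norming functionals by the Hahn-Banach theorem\<close>

definition sublinear :: "('a::real_vector \<Rightarrow> real) \<Rightarrow> bool" where
  "sublinear p \<longleftrightarrow> (\<forall>x y. p (x + y) \<le> p x + p y) \<and> (\<forall>t\<ge>0. \<forall>x. p (t *\<^sub>R x) \<le> t * p x)"

lemma sublinear_add: "sublinear p \<Longrightarrow> p (x + y) \<le> p x + p y"
  by (simp add: sublinear_def)

lemma sublinear_scaleR: "sublinear p \<Longrightarrow> 0 \<le> t \<Longrightarrow> p (t *\<^sub>R x) \<le> t * p x"
  by (simp add: sublinear_def)

lemma sublinear_zero: "sublinear p \<Longrightarrow> p 0 = 0"
  using sublinear_add[of p 0 0] sublinear_scaleR[of p 0 0] by simp

lemma sublinear_neg: "sublinear p \<Longrightarrow> - p (- x) \<le> p x"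
  using sublinear_add[of p x "- x"] sublinear_zero[of p] by simp

lemma sublinear_scaleR_eq:
  assumes p: "sublinear p" and t: "0 \<le> t"
  shows "p (t *\<^sub>R x) = t * p x"
proof (cases "t = 0")
  case False
  with t have t: "0 < t" by simp
  have "t * p (inverse t *\<^sub>R t *\<^sub>R x) \<le> t * (inverse t * p (t *\<^sub>R x))"
    using t by (intro mult_left_mono sublinear_scaleR[OF p]) auto
  then have "t * p x \<le> p (t *\<^sub>R x)" using t by (simp flip: mult.assoc)
  with sublinear_scaleR[OF p, of t x] t show ?thesis by simp
qed (simp add: sublinear_zero[OF p])

text \<open>The largest sublinear functional below \<open>p\<close> whose value at \<open>- x\<close> is at most \<open>- p x\<close>. A
  sublinear functional with nothing strictly below it coincides with all its tilts, which forces
  it to be additive; tilting the norm at \<open>h\<close> forces a linear minorant to attain the norm at \<open>h\<close>.\<close>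

definition tilt :: "('a::real_vector \<Rightarrow> real) \<Rightarrow> 'a \<Rightarrow> 'a \<Rightarrow> real" where
  "tilt p x z = (INF t\<in>{0..}. p (z + t *\<^sub>R x) - t * p x)"

lemma tilt_le:
  assumes p: "sublinear p" and t: "0 \<le> t"
  shows "tilt p x z \<le> p (z + t *\<^sub>R x) - t * p x"
  unfolding tilt_def
proof (rule cINF_lower)
  show "bdd_below ((\<lambda>t. p (z + t *\<^sub>R x) - t * p x) ` {0..})"
  proof (rule bdd_belowI2)
    fix u :: real assume "u \<in> {0..}"
    then have "p (u *\<^sub>R x) = u * p x"
      by (simp add: sublinear_scaleR_eq[OF p])
    moreover have "p (u *\<^sub>R x) \<le> p (z + u *\<^sub>R x) + p (- z)"
      using sublinear_add[OF p, of "z + u *\<^sub>R x" "- z"] by simp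
    ultimately show "- p (- z) \<le> p (z + u *\<^sub>R x) - u * p x" by simp
  qed
qed (use t in simp)

lemma le_tilt:
  assumes "\<And>t. 0 \<le> t \<Longrightarrow> a \<le> p (z + t *\<^sub>R x) - t * p x"
  shows "a \<le> tilt p x z"
  unfolding tilt_def using assms by (intro cINF_greatest) auto

lemma sublinear_tilt:
  assumes p: "sublinear p"
  shows "sublinear (tilt p x)"
  unfolding sublinear_def
proof (intro conjI allI impI)
  fix z w
  have "tilt p x (z + w) - (p (w + u *\<^sub>R x) - u * p x) \<le> p (z + t *\<^sub>R x) - t * p x"
    if "0 \<le> t" "0 \<le> u" for t u
    using tilt_le[OF p, of "t + u" x "z + w"] that
      sublinear_add[OF p, of "z + t *\<^sub>R x" "w + u *\<^sub>R x"] by (simp add: algebra_simps)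
  then have "tilt p x (z + w) - (p (w + u *\<^sub>R x) - u * p x) \<le> tilt p x z" if "0 \<le> u" for u
    using that by (intro le_tilt)
  then have "tilt p x (z + w) - tilt p x z \<le> p (w + u *\<^sub>R x) - u * p x" if "0 \<le> u" for u
    using that by (simp add: algebra_simps)
  then have "tilt p x (z + w) - tilt p x z \<le> tilt p x w" by (rule le_tilt)
  then show "tilt p x (z + w) \<le> tilt p x z + tilt p x w" by simp
next
  fix c :: real and z assume "0 \<le> c"
  show "tilt p x (c *\<^sub>R z) \<le> c * tilt p x z"
  proof (cases "c = 0")
    case True
    then show ?thesis using tilt_le[OF p, of 0 x 0] sublinear_zero[OF p] by simp
  next
    case False
    with \<open>0 \<le> c\<close> have c: "c > 0" by simp
    have "tilt p x (c *\<^sub>R z) / c \<le> p (z + t *\<^sub>R x) - t * p x" if "0 \<le> t" for t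
    proof -
      have "tilt p x (c *\<^sub>R z) \<le> p (c *\<^sub>R (z + t *\<^sub>R x)) - c * t * p x"
        using tilt_le[OF p, of "c * t" x "c *\<^sub>R z"] that c by (simp add: scaleR_add_right)
      also have "\<dots> \<le> (p (z + t *\<^sub>R x) - t * p x) * c"
        using sublinear_scaleR[OF p, of c "z + t *\<^sub>R x"] c by (simp add: algebra_simps)
      finally show ?thesis using c by (simp only: pos_divide_le_eq)
    qed
    then have "tilt p x (c *\<^sub>R z) / c \<le> tilt p x z" by (rule le_tilt)
    then show ?thesis using c by (simp add: pos_divide_le_eq algebra_simps)
  qed
qed

text \<open>Zorn's lemma, applied downwards to the sublinear functionals below \<open>p\<close>, gives a minimal one
  \<open>m\<close>. Since \<open>tilt m x\<close> is again sublinear and below \<open>m\<close>, it equals \<open>m\<close>, and its value at \<open>z\<close> is at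
  most \<open>m (z + x) - m x\<close>; together with subadditivity this is additivity of \<open>m\<close>.\<close>

lemma linear_minorant:
  fixes p :: "'a::real_vector \<Rightarrow> real"
  assumes p: "sublinear p"
  obtains \<phi> where "linear \<phi>" "\<And>x. \<phi> x \<le> p x"
proof -
  define A where "A = {q. sublinear q \<and> (\<forall>x. q x \<le> p x)}"
  have "\<exists>m\<in>A. \<forall>q\<in>A. q \<le> m \<longrightarrow> q = m"
  proof (rule predicate_Zorn)
    show "partial_order_on A (relation_of (\<lambda>m q. q \<le> m) A)"
      by (rule partial_order_on_relation_ofI) auto
    fix C assume C: "C \<in> Chains (relation_of (\<lambda>m q. q \<le> m) A)"
    then have CA: "C \<subseteq> A" by (rule Chains_relation_of)
    have tot: "q \<le> r \<or> r \<le> q" if "q \<in> C" "r \<in> C" for q r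
      using C that by (auto simp: Chains_def relation_of_def)
    show "\<exists>u\<in>A. \<forall>a\<in>C. u \<le> a"
    proof (cases "C = {}")
      case True
      then show ?thesis using p by (auto simp: A_def)
    next
      case False
      \<comment> \<open>The pointwise infimum of a chain is finite, as \<open>- p (- x)\<close> bounds every member from below.\<close>
      define u where "u x = (INF q\<in>C. q x)" for x
      have lb: "- p (- x) \<le> q x" if "q \<in> C" for q x
      proof -
        have "sublinear q" "q (- x) \<le> p (- x)" using that CA by (auto simp: A_def)
        then show ?thesis using sublinear_neg[of q x] by simp
      qed
      have le: "u x \<le> q x" if "q \<in> C" for q x
        unfolding u_def by (rule cINF_lower[OF bdd_belowI2 that]) (rule lb)
      have ge: "a \<le> u x" if "\<And>q. q \<in> C \<Longrightarrow> a \<le> q x" for a x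
        unfolding u_def using False that by (rule cINF_greatest)
      have sub: "sublinear u" unfolding sublinear_def
      proof (intro conjI allI impI)
        fix x y
        have "u (x + y) \<le> q x + r y" if q: "q \<in> C" and r: "r \<in> C" for q r
          using tot[OF q r]
        proof
          assume "q \<le> r"
          then have "q y \<le> r y" by (simp add: le_fun_def)
          then show ?thesis
            using le[OF q, of "x + y"] sublinear_add[of q x y] q CA by (auto simp: A_def)
        next
          assume "r \<le> q"
          then have "r x \<le> q x" by (simp add: le_fun_def)
          then show ?thesis
            using le[OF r, of "x + y"] sublinear_add[of r x y] r CA by (auto simp: A_def)
        qed
        then have "u (x + y) - r y \<le> u x" if "r \<in> C" for r
          using that by (intro ge) (simp add: algebra_simps)
        then have "u (x + y) - u x \<le> u y" by (intro ge) (simp add: algebra_simps)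
        then show "u (x + y) \<le> u x + u y" by simp
      next
        fix t :: real and x assume t: "0 \<le> t"
        show "u (t *\<^sub>R x) \<le> t * u x"
        proof (cases "t = 0")
          case True
          obtain q where q: "q \<in> C" using False by auto
          then have "q 0 = 0" using CA sublinear_zero by (auto simp: A_def)
          with True show ?thesis using le[OF q, of 0] by simp
        next
          case False
          with t have t: "t > 0" by simp
          have "u (t *\<^sub>R x) / t \<le> q x" if q: "q \<in> C" for q
          proof -
            have "q (t *\<^sub>R x) \<le> t * q x"
              using q CA t by (intro sublinear_scaleR) (auto simp: A_def)
            with le[OF q, of "t *\<^sub>R x"] t show ?thesis
              by (simp add: pos_divide_le_eq algebra_simps)
          qed
          then have "u (t *\<^sub>R x) / t \<le> u x" by (rule ge)
          then show ?thesis using t by (simp add: pos_divide_le_eq algebra_simps)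
        qed
      qed
      have "u x \<le> p x" for x
        using False le CA by (force simp: A_def intro: order_trans)
      with sub have "u \<in> A" by (simp add: A_def)
      with le show ?thesis by (auto simp: le_fun_def)
    qed
  qed
  then obtain m where m: "m \<in> A" and min: "\<And>q. q \<in> A \<Longrightarrow> q \<le> m \<Longrightarrow> q = m" by blast
  have sub: "sublinear m" and mp: "m x \<le> p x" for x using m by (auto simp: A_def)
  have tilt: "tilt m x = m" for x
  proof (rule min)
    have "tilt m x z \<le> m z" for z using tilt_le[OF sub, of 0 x z] by simp
    then show "tilt m x \<le> m" and "tilt m x \<in> A"
      using mp sublinear_tilt[OF sub] by (auto simp: le_fun_def A_def intro: order_trans)
  qed
  have add: "m (z + x) = m z + m x" for z x
    using tilt_le[OF sub, of 1 x z] tilt[of x] sublinear_add[OF sub, of z x] by simp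
  have neg: "m (- x) = - m x" for x
    using add[of x "- x"] sublinear_zero[OF sub] by simp
  have nn: "m (t *\<^sub>R x) = t * m x" if "0 \<le> t" for t x
    using sublinear_scaleR[OF sub that, of x] sublinear_scaleR[OF sub that, of "- x"]
    by (simp add: neg)
  have "m (t *\<^sub>R x) = t * m x" for t x
    using nn[of t x] nn[of "- t" x] neg[of "t *\<^sub>R x"] by (cases "0 \<le> t") auto
  with add have "linear m" by (intro linearI) auto
  with mp show ?thesis by (rule that[rotated -1])
qed

lemma Hahn_Banach_norming:
  fixes h :: "'a::real_normed_vector"
  obtains \<phi> where "linear \<phi>" "\<And>x. \<bar>\<phi> x\<bar> \<le> norm x" "\<phi> h = norm h"
proof -
  have n: "sublinear (norm :: 'a \<Rightarrow> real)"
    by (simp add: sublinear_def norm_triangle_ineq)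
  obtain \<phi> where \<phi>: "linear \<phi>" and le: "\<And>x. \<phi> x \<le> tilt norm h x"
    using linear_minorant[OF sublinear_tilt[OF n]] by blast
  have le': "\<phi> x \<le> norm x" for x
    using le[of x] tilt_le[OF n, of 0 h x] by simp
  have "\<phi> (- h) \<le> - norm h"
    using le[of "- h"] tilt_le[OF n, of 1 h "- h"] by simp
  then have "\<phi> h = norm h"
    using le'[of h] by (simp add: linear_neg[OF \<phi>])
  moreover have "\<bar>\<phi> x\<bar> \<le> norm x" for x
    using le'[of x] le'[of "- x"] by (simp add: linear_neg[OF \<phi>])
  ultimately show ?thesis using \<phi> that by blast
qed

lemma scaleC_one [simp]: "1 *\<^sub>C x = (x::'a::complex_normed_vector)"
  using scaleR_scaleC[of 1 x] by simp

lemma scaleC_minus_one: "(- 1) *\<^sub>C x = - (x::'a::complex_normed_vector)"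
  using scaleR_scaleC[of "- 1" x] by simp

lemma scaleC_zero_left: "0 *\<^sub>C x = (0::'a::complex_normed_vector)"
  using scaleR_scaleC[of 0 x] by simp

lemma bounded_linear_cdual_apply: "bounded_linear (cdual_apply y)"
  by transfer (rule blinfun.bounded_linear_right)

lemma cdual_apply_scaleC_right: "cdual_apply y (c *\<^sub>C x) = c * cdual_apply y x"
  by transfer simp

lemma cdual_apply_add_right: "cdual_apply y (x + x') = cdual_apply y x + cdual_apply y x'"
  by (rule linear_add[OF bounded_linear.linear[OF bounded_linear_cdual_apply]])

lemma cdual_apply_diff_right: "cdual_apply y (x - x') = cdual_apply y x - cdual_apply y x'"
  by (rule linear_diff[OF bounded_linear.linear[OF bounded_linear_cdual_apply]])

lemma cdual_apply_diff_left: "cdual_apply (y - z) x = cdual_apply y x - cdual_apply z x"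
  using cdual_apply_add_left[of "y - z" z x] by simp

lemma cdual_of_complex_linear:
  fixes \<psi> :: "'a::complex_normed_vector \<Rightarrow> complex"
  assumes add: "\<And>x y. \<psi> (x + y) = \<psi> x + \<psi> y"
    and scale: "\<And>c x. \<psi> (c *\<^sub>C x) = c * \<psi> x"
    and bound: "\<And>x. cmod (\<psi> x) \<le> K * norm x" and K: "0 \<le> K"
  obtains \<Psi> :: "'a cdual" where "cdual_apply \<Psi> = \<psi>" "norm \<Psi> \<le> K"
proof
  have bl: "bounded_linear \<psi>"
    by (rule bounded_linear_intro[where K = K])
      (simp_all add: add scale scaleR_scaleC[where 'a = 'a] scaleR_conv_of_real bound mult.commute)
  then have in_dual: "Blinfun \<psi> \<in> {\<phi>. \<forall>c x. blinfun_apply \<phi> (c *\<^sub>C x) = c * blinfun_apply \<phi> x}"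
    by (simp add: bounded_linear_Blinfun_apply scale)
  show "cdual_apply (Abs_cdual (Blinfun \<psi>)) = \<psi>"
    by (simp add: cdual_apply.rep_eq Abs_cdual_inverse[OF in_dual] bounded_linear_Blinfun_apply[OF bl])
  show "norm (Abs_cdual (Blinfun \<psi>)) \<le> K"
    unfolding norm_cdual.rep_eq Abs_cdual_inverse[OF in_dual]
    using K bound by (intro norm_blinfun_bound) (simp_all add: bounded_linear_Blinfun_apply[OF bl])
qed

text \<open>The usual complexification \<open>\<phi>(x) - \<i> \<phi>(\<i> x)\<close> of a real norming functional. Its norm is in fact
  at most 1, but the crude bound 2 is immediate and costs only a constant later.\<close>

lemma cdual_almost_norming:
  fixes h :: "'a::complex_normed_vector"
  obtains \<Psi> :: "'a cdual" where "norm \<Psi> \<le> 2" "norm h \<le> cmod (cdual_apply \<Psi> h)"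
proof -
  obtain \<phi> where \<phi>: "linear \<phi>" "\<And>x. \<bar>\<phi> x\<bar> \<le> norm x" "\<phi> h = norm h"
    using Hahn_Banach_norming[of h] by blast
  define \<psi> where "\<psi> x = Complex (\<phi> x) (- \<phi> (\<i> *\<^sub>C x))" for x
  have re: "\<phi> (r *\<^sub>R x) = r * \<phi> x" for r x by (simp add: linear_cmul[OF \<phi>(1)])
  have add: "\<phi> (x + y) = \<phi> x + \<phi> y" for x y by (simp add: linear_add[OF \<phi>(1)])
  have split: "\<phi> (c *\<^sub>C x) = Re c * \<phi> x + Im c * \<phi> (\<i> *\<^sub>C x)" for c x
  proof -
    have "c *\<^sub>C x = Re c *\<^sub>R x + Im c *\<^sub>R (\<i> *\<^sub>C x)"
      unfolding scaleR_scaleC[where 'a = 'a] scaleC_scaleC scaleC_add_left[symmetric]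
      by (subst complex_eq[of c]) (simp add: mult.commute)
    then show ?thesis by (simp add: add re)
  qed
  have "\<psi> (x + y) = \<psi> x + \<psi> y" for x y
    by (simp add: \<psi>_def add scaleC_add_right complex_eq_iff)
  moreover have "\<psi> (c *\<^sub>C x) = c * \<psi> x" for c x
    using split[of c x] split[of "\<i> * c" x]
    by (simp add: \<psi>_def scaleC_scaleC complex_eq_iff)
  moreover have "cmod (\<psi> x) \<le> 2 * norm x" for x
    using cmod_le[of "\<psi> x"] \<phi>(2)[of x] \<phi>(2)[of "\<i> *\<^sub>C x"]
    by (simp add: \<psi>_def norm_scaleC)
  ultimately obtain \<Psi> :: "'a cdual" where \<Psi>: "cdual_apply \<Psi> = \<psi>" "norm \<Psi> \<le> 2"
    using cdual_of_complex_linear[of \<psi> 2] zero_le_numeral by blast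
  moreover have "norm h \<le> cmod (\<psi> h)"
    using abs_Re_le_cmod[of "\<psi> h"] \<phi>(3) by (simp add: \<psi>_def)
  ultimately show ?thesis using that by metis
qed

section \<open>A minimax theorem for finitely many functions\<close>

text \<open>The image of \<open>K\<close> in the plane is compact and convex. If it missed the closed positive quadrant,
  a separating line would have a normal vector \<open>(a, b)\<close> with nonnegative coordinates, and
  \<open>a \<psi> + b \<phi>\<close> would be negative on \<open>K\<close>. Convexity enters only through the convexity of this
  image, so \<open>K\<close> may live in a space of functions that carries no vector space structure as a type.\<close>

lemma two_function_minimax:
  fixes \<psi> \<phi> :: "'a::topological_space \<Rightarrow> real"
  assumes K: "compact K" and cont: "continuous_on K \<psi>" "continuous_on K \<phi>"
    and conv: "\<And>u v t. u \<in> K \<Longrightarrow> v \<in> K \<Longrightarrow> 0 \<le> t \<Longrightarrow> t \<le> 1 \<Longrightarrow>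
      \<exists>w\<in>K. \<psi> w = (1 - t) * \<psi> u + t * \<psi> v \<and> \<phi> w = (1 - t) * \<phi> u + t * \<phi> v"
    and comb: "\<And>a b. 0 \<le> a \<Longrightarrow> 0 \<le> b \<Longrightarrow> \<exists>k\<in>K. 0 \<le> a * \<psi> k + b * \<phi> k"
  shows "\<exists>k\<in>K. 0 \<le> \<psi> k \<and> 0 \<le> \<phi> k"
proof (rule ccontr)
  assume neg: "\<not> ?thesis"
  define P where "P = (\<lambda>k. (\<psi> k, \<phi> k)) ` K"
  define Q :: "(real \<times> real) set" where "Q = {0..} \<times> {0..}"
  have "compact P"
    unfolding P_def using K cont by (intro compact_continuous_image continuous_on_Pair)
  moreover have "P \<noteq> {}" using comb[of 0 0] by (auto simp: P_def)
  moreover have "convex P" unfolding convex_alt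
  proof (intro ballI allI impI)
    fix x y and t :: real assume "x \<in> P" "y \<in> P" "0 \<le> t \<and> t \<le> 1"
    then obtain u v where uv: "u \<in> K" "v \<in> K" "x = (\<psi> u, \<phi> u)" "y = (\<psi> v, \<phi> v)" "0 \<le> t" "t \<le> 1"
      by (auto simp: P_def)
    obtain w where "w \<in> K" "\<psi> w = (1 - t) * \<psi> u + t * \<psi> v" "\<phi> w = (1 - t) * \<phi> u + t * \<phi> v"
      using conv[OF uv(1,2,5,6)] by blast
    then show "(1 - t) *\<^sub>R x + t *\<^sub>R y \<in> P"
      unfolding P_def by (intro image_eqI[of _ _ w]) (simp_all add: uv)
  qed
  moreover have "convex Q" unfolding Q_def by (intro convex_Times convex_real_interval)
  moreover have "closed Q" unfolding Q_def by (intro closed_Times closed_atLeast)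
  moreover have "P \<inter> Q = {}" using neg by (auto simp: P_def Q_def)
  ultimately obtain n d where sep: "\<And>x. x \<in> P \<Longrightarrow> n \<bullet> x < d" "\<And>x. x \<in> Q \<Longrightarrow> d < n \<bullet> x"
    using separating_hyperplane_compact_closed by metis
  obtain a b where n: "n = (a, b)" by (cases n)
  have d: "d < 0" using sep(2)[of "(0, 0)"] by (simp add: Q_def n)
  \<comment> \<open>A negative coordinate of the normal vector is refuted by a far point on its axis.\<close>
  have "0 \<le> a"
  proof (rule ccontr)
    assume "\<not> 0 \<le> a"
    then show False using d sep(2)[of "(d / a, 0)"] by (simp add: Q_def n divide_nonpos_neg)
  qed
  moreover have "0 \<le> b"
  proof (rule ccontr)
    assume "\<not> 0 \<le> b"
    then show False using d sep(2)[of "(0, d / b)"] by (simp add: Q_def n divide_nonpos_neg)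
  qed
  ultimately obtain k where "k \<in> K" "0 \<le> a * \<psi> k + b * \<phi> k" using comb by blast
  then show False using sep(1)[of "(\<psi> k, \<phi> k)"] d by (auto simp: P_def n)
qed

text \<open>Induction on the number of functions, replacing \<open>K\<close> by the part where the new function is
  nonnegative. That this part still meets the hypothesis for each nonnegative combination of the
  old functions is the case of two functions.\<close>

lemma finite_minimax:
  fixes \<phi> :: "'i \<Rightarrow> 'a::topological_space \<Rightarrow> real"
  assumes "finite I" and "compact K"
    and "\<And>i. i \<in> I \<Longrightarrow> continuous_on UNIV (\<phi> i)"
    and "\<And>u v t. u \<in> K \<Longrightarrow> v \<in> K \<Longrightarrow> 0 \<le> t \<Longrightarrow> t \<le> 1 \<Longrightarrow>
      \<exists>w\<in>K. \<forall>i\<in>I. \<phi> i w = (1 - t) * \<phi> i u + t * \<phi> i v"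
    and "\<And>l. (\<And>i. i \<in> I \<Longrightarrow> 0 \<le> l i) \<Longrightarrow> \<exists>k\<in>K. 0 \<le> (\<Sum>i\<in>I. l i * \<phi> i k)"
  shows "\<exists>k\<in>K. \<forall>i\<in>I. 0 \<le> \<phi> i k"
  using assms
proof (induction I arbitrary: K rule: finite_induct)
  case empty
  then show ?case by auto
next
  case (insert j I)
  define K' where "K' = K \<inter> {k. 0 \<le> \<phi> j k}"
  have cont: "continuous_on UNIV (\<phi> i)" if "i \<in> insert j I" for i using insert.prems(2) that .
  have "\<exists>k\<in>K'. \<forall>i\<in>I. 0 \<le> \<phi> i k"
  proof (rule insert.IH)
    show "compact K'" unfolding K'_def
      using cont by (intro compact_Int_closed insert.prems(1) closed_Collect_le) auto
    show "continuous_on UNIV (\<phi> i)" if "i \<in> I" for i using that cont by simp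
    show "\<exists>w\<in>K'. \<forall>i\<in>I. \<phi> i w = (1 - t) * \<phi> i u + t * \<phi> i v"
      if uv: "u \<in> K'" "v \<in> K'" "0 \<le> t" "t \<le> 1" for u v t
    proof -
      obtain w where w: "w \<in> K" "\<forall>i\<in>insert j I. \<phi> i w = (1 - t) * \<phi> i u + t * \<phi> i v"
        using insert.prems(3)[of u v t] uv by (auto simp: K'_def)
      moreover have "0 \<le> \<phi> j w" using w(2) uv by (auto simp: K'_def)
      ultimately show ?thesis by (auto simp: K'_def)
    qed
    fix l :: "'i \<Rightarrow> real" assume l: "\<And>i. i \<in> I \<Longrightarrow> 0 \<le> l i"
    let ?\<psi> = "\<lambda>k. \<Sum>i\<in>I. l i * \<phi> i k"
    have "\<exists>k\<in>K. 0 \<le> ?\<psi> k \<and> 0 \<le> \<phi> j k"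
    proof (rule two_function_minimax[OF insert.prems(1)])
      show "continuous_on K ?\<psi>"
        using cont by (intro continuous_intros continuous_on_subset[OF cont]) auto
      show "continuous_on K (\<phi> j)" by (rule continuous_on_subset[OF cont]) auto
      show "\<exists>w\<in>K. ?\<psi> w = (1 - t) * ?\<psi> u + t * ?\<psi> v \<and> \<phi> j w = (1 - t) * \<phi> j u + t * \<phi> j v"
        if uv: "u \<in> K" "v \<in> K" "0 \<le> t" "t \<le> 1" for u v t
      proof -
        obtain w where w: "w \<in> K" "\<forall>i\<in>insert j I. \<phi> i w = (1 - t) * \<phi> i u + t * \<phi> i v"
          using insert.prems(3)[OF uv] by blast
        have "?\<psi> w = (\<Sum>i\<in>I. (1 - t) * (l i * \<phi> i u) + t * (l i * \<phi> i v))"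
          by (intro sum.cong refl) (simp add: w(2) algebra_simps)
        then have "?\<psi> w = (1 - t) * ?\<psi> u + t * ?\<psi> v"
          by (simp add: sum.distrib sum_distrib_left)
        then show ?thesis using w(1) bspec[OF w(2), of j] by blast
      qed
      show "\<exists>k\<in>K. 0 \<le> a * ?\<psi> k + b * \<phi> j k" if ab: "0 \<le> a" "0 \<le> b" for a b
      proof -
        let ?l = "\<lambda>i. if i = j then b else a * l i"
        have "\<exists>k\<in>K. 0 \<le> (\<Sum>i\<in>insert j I. ?l i * \<phi> i k)"
          by (rule insert.prems(4)) (use l ab in auto)
        then obtain k where k: "k \<in> K" "0 \<le> (\<Sum>i\<in>insert j I. ?l i * \<phi> i k)" by blast
        have "(\<Sum>i\<in>I. ?l i * \<phi> i k) = a * ?\<psi> k"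
          unfolding sum_distrib_left using insert.hyps(2) by (intro sum.cong) auto
        then show ?thesis using k insert.hyps by (auto simp: add.commute)
      qed
    qed
    then show "\<exists>k\<in>K'. 0 \<le> ?\<psi> k" by (auto simp: K'_def)
  qed
  then show ?case by (auto simp: K'_def)
qed

section \<open>Domination by a positive Hermitian form on the dual\<close>

text \<open>The forms \<open>(y, z) \<mapsto> \<integral> \<eta>(y) cnj(\<eta>(z)) d\<mu>(\<eta>)\<close> of the probability measures \<open>\<mu>\<close> on the unit ball of the
  bidual have all these properties. The properties are closed under pointwise limits and under
  convex combinations, and the last one is the only trace of \<open>\<mu>\<close> that remains. The bound
  on \<open>s (y, z)\<close> makes Tychonoff's theorem applicable. Forms are
  functions of a pair so that one product topology suffices.\<close>

definition dominated_forms :: "('f::complex_normed_vector cdual \<times> 'f cdual \<Rightarrow> complex) set" where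
  "dominated_forms = {s.
     (\<forall>y y' z. s (y + y', z) = s (y, z) + s (y', z)) \<and>
     (\<forall>c y z. s (c *\<^sub>C y, z) = c * s (y, z)) \<and>
     (\<forall>y z. s (z, y) = cnj (s (y, z))) \<and>
     (\<forall>y. 0 \<le> Re (s (y, y))) \<and>
     (\<forall>y z. cmod (s (y, z)) \<le> norm y * norm z) \<and>
     (\<forall>n ys. (\<Sum>i=1..n. Re (s (ys i, ys i))) \<le> (weak_l2_norm n ys)\<^sup>2)}"

lemma dominated_formsD:
  assumes "s \<in> dominated_forms"
  shows dominated_forms_add: "s (y + y', z) = s (y, z) + s (y', z)"
    and dominated_forms_scale: "s (c *\<^sub>C y, z) = c * s (y, z)"
    and dominated_forms_hermitian: "s (z, y) = cnj (s (y, z))"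
    and dominated_forms_nonneg: "0 \<le> Re (s (y, y))"
    and dominated_forms_bound: "cmod (s (y, z)) \<le> norm y * norm z"
    and dominated_forms_weak: "(\<Sum>i=1..n. Re (s (ys i, ys i))) \<le> (weak_l2_norm n ys)\<^sup>2"
proof -
  note D = assms[unfolded dominated_forms_def mem_Collect_eq]
  show "s (y + y', z) = s (y, z) + s (y', z)" using D by blast
  show "s (c *\<^sub>C y, z) = c * s (y, z)" using D by blast
  show "s (z, y) = cnj (s (y, z))" using D by blast
  show "0 \<le> Re (s (y, y))" using D by blast
  show "cmod (s (y, z)) \<le> norm y * norm z" using D by blast
  show "(\<Sum>i=1..n. Re (s (ys i, ys i))) \<le> (weak_l2_norm n ys)\<^sup>2" using D by blast
qed

lemma compact_pointwise_bounded:
  "compact {s :: 'a \<Rightarrow> complex. \<forall>p. cmod (s p) \<le> b p}"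
proof -
  have eq: "{s :: 'a \<Rightarrow> complex. \<forall>p. cmod (s p) \<le> b p} = PiE UNIV (\<lambda>p. cball 0 (b p))"
    by (auto simp: PiE_def)
  have "compactin (product_topology (\<lambda>_. euclidean) UNIV) (PiE UNIV (\<lambda>p. cball (0::complex) (b p)))"
    unfolding compactin_PiE by simp
  then show ?thesis unfolding eq euclidean_product_topology by simp
qed

lemma compact_dominated_forms: "compact (dominated_forms :: ('f::complex_normed_vector cdual \<times> 'f cdual \<Rightarrow> complex) set)"
proof -
  have "closed (dominated_forms :: ('f cdual \<times> 'f cdual \<Rightarrow> complex) set)"
    unfolding dominated_forms_def
    by (intro closed_Collect_conj closed_Collect_all closed_Collect_eq closed_Collect_le
        continuous_intros continuous_on_product_coordinates)
  then have "compact ({s. \<forall>p. cmod (s p) \<le> norm (fst p) * norm (snd p)} \<inter>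
      (dominated_forms :: ('f cdual \<times> 'f cdual \<Rightarrow> complex) set))"
    by (rule compact_Int_closed[OF compact_pointwise_bounded])
  moreover have "{s. \<forall>p. cmod (s p) \<le> norm (fst p) * norm (snd p)} \<inter>
      (dominated_forms :: ('f cdual \<times> 'f cdual \<Rightarrow> complex) set) = dominated_forms"
    by (auto simp: dominated_forms_def)
  ultimately show ?thesis by simp
qed

lemma dominated_forms_convex:
  assumes u: "u \<in> dominated_forms" and v: "v \<in> dominated_forms" and t: "0 \<le> t" "t \<le> 1"
  shows "(\<lambda>p. complex_of_real (1 - t) * u p + complex_of_real t * v p) \<in> dominated_forms"
proof -
  have bound: "cmod (complex_of_real (1 - t) * u (y, z) + complex_of_real t * v (y, z)) \<le> norm y * norm z" for y z
  proof -
    have "cmod (complex_of_real (1 - t) * u (y, z) + complex_of_real t * v (y, z)) \<le>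
        (1 - t) * cmod (u (y, z)) + t * cmod (v (y, z))"
      using norm_triangle_ineq[of "complex_of_real (1 - t) * u (y, z)" "complex_of_real t * v (y, z)"] t
      by (simp only: norm_mult norm_of_real abs_of_nonneg)
    also have "\<dots> \<le> norm y * norm z"
      using dominated_forms_bound[OF u] dominated_forms_bound[OF v] t
      by (intro convex_bound_le) auto
    finally show ?thesis .
  qed
  have sum: "(\<Sum>i=1..n. Re (complex_of_real (1 - t) * u (ys i, ys i) + complex_of_real t * v (ys i, ys i)))
      \<le> (weak_l2_norm n ys)\<^sup>2" for n and ys :: "nat \<Rightarrow> 'a cdual"
  proof -
    have "(\<Sum>i=1..n. Re (complex_of_real (1 - t) * u (ys i, ys i) + complex_of_real t * v (ys i, ys i))) =
        (1 - t) * (\<Sum>i=1..n. Re (u (ys i, ys i))) + t * (\<Sum>i=1..n. Re (v (ys i, ys i)))"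
      by (simp only: sum_distrib_left sum.distrib[symmetric]) simp
    also have "\<dots> \<le> (weak_l2_norm n ys)\<^sup>2"
      using t by (intro convex_bound_le dominated_forms_weak u v) auto
    finally show ?thesis .
  qed
  have pos: "0 \<le> Re (complex_of_real (1 - t) * u (y, y) + complex_of_real t * v (y, y))" for y
    using dominated_forms_nonneg[OF u] dominated_forms_nonneg[OF v] t by simp
  have "cnj (u (y, z)) = u (z, y)" "cnj (v (y, z)) = v (z, y)" for y z
    using dominated_forms_hermitian[OF u, of z y] dominated_forms_hermitian[OF v, of z y] by simp_all
  then show ?thesis
    unfolding dominated_forms_def mem_Collect_eq
    using bound sum pos by (intro conjI allI) (simp_all add: dominated_forms_add[OF u] dominated_forms_add[OF v]
        dominated_forms_scale[OF u] dominated_forms_scale[OF v] algebra_simps)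
qed

lemma Re_mult_cnj: "Re (z * cnj z) = (cmod z)\<^sup>2"
  unfolding cmod_power2 by (simp add: power2_eq_square)

text \<open>The point masses among the measures. They make the supremum of \<open>\<Sum> l\<^sub>i s(y\<^sub>i, y\<^sub>i)\<close> over all dominated
  forms at least the squared weak \<open>l\<^sub>2\<close> norm of \<open>\<surd>l\<^sub>i y\<^sub>i\<close>.\<close>

lemma rank_one_dominated:
  fixes \<eta> :: "'f::complex_normed_vector cdual cdual"
  assumes \<eta>: "\<eta> \<in> cball 0 1"
  shows "(\<lambda>(y, z). cdual_apply \<eta> y * cnj (cdual_apply \<eta> z)) \<in> dominated_forms"
proof -
  have le: "cmod (cdual_apply \<eta> y) \<le> norm y" for y
    using norm_cdual_apply[of \<eta> y] \<eta> mult_right_mono[of "norm \<eta>" 1 "norm y"] by simp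
  have "(\<Sum>i=1..n. (cmod (cdual_apply \<eta> (ys i)))\<^sup>2) \<le> (weak_l2_norm n ys)\<^sup>2" for n ys
  proof -
    have "sqrt (\<Sum>i=1..n. (cmod (cdual_apply \<eta> (ys i)))\<^sup>2) \<le> weak_l2_norm n ys"
      unfolding weak_l2_norm_def by (rule cSUP_upper[OF \<eta> weak_l2_norm_bdd_above])
    then show ?thesis by (rule sqrt_le_D)
  qed
  with le show ?thesis
    unfolding dominated_forms_def mem_Collect_eq prod.case Re_mult_cnj
    by (intro conjI allI) (simp_all add: cdual_apply_add_right cdual_apply_scaleC_right
        norm_mult mult_mono algebra_simps)
qed

text \<open>Each pair \<open>(x, y)\<close> imposes a closed condition on \<open>s\<close>, so by compactness finitely many
  pairs suffice, and by the minimax lemma a single nonnegative combination of the conditions. For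
  weights \<open>l\<^sub>i\<close> the combined condition is
  \<open>\<Sum> l\<^sub>i |y\<^sub>i(f x\<^sub>i)|\<^sup>2 \<le> C\<^sup>2 \<Sum> l\<^sub>i s(y\<^sub>i, y\<^sub>i)\<close> for some \<open>s\<close>. This is
  the summing inequality for the functionals \<open>\<surd>l\<^sub>i y\<^sub>i\<close> and the scalars \<open>\<surd>l\<^sub>i |y\<^sub>i(f x\<^sub>i)|\<close>, whose square sum
  is the left-hand side itself.\<close>

theorem Pietsch_domination_by_form:
  fixes f :: "'e \<Rightarrow> 'f::complex_normed_vector"
  assumes C: "0 \<le> C"
    and summing: "\<forall>n (a :: nat \<Rightarrow> complex) x (ys :: nat \<Rightarrow> 'f cdual). (\<forall>i\<in>{1..n}. x i \<in> U) \<longrightarrow>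
       (\<Sum>i=1..n. cmod (a i) * cmod (cdual_apply (ys i) (f (x i))))
         \<le> C * sqrt (\<Sum>i=1..n. (cmod (a i))\<^sup>2) * weak_l2_norm n ys"
  shows "\<exists>s\<in>dominated_forms. \<forall>x\<in>U. \<forall>y.
    (cmod (cdual_apply y (f x)))\<^sup>2 \<le> C\<^sup>2 * Re (s (y, y))"
proof -
  define v where "v = (\<lambda>(x, y). (cmod (cdual_apply y (f x)))\<^sup>2)"
  define \<phi> where "\<phi> i s = C\<^sup>2 * Re (s (snd i, snd i)) - v i"
    for i and s :: "'f cdual \<times> 'f cdual \<Rightarrow> complex"
  have cont: "continuous_on UNIV (\<phi> i)" for i
    unfolding \<phi>_def by (intro continuous_intros continuous_on_product_coordinates)
  have "\<exists>k\<in>dominated_forms. \<forall>i\<in>I. 0 \<le> \<phi> i k" if fin: "finite I" and IU: "I \<subseteq> U \<times> UNIV" for I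
  proof (rule finite_minimax[OF fin compact_dominated_forms cont])
    fix s s' :: "'f cdual \<times> 'f cdual \<Rightarrow> complex" and t :: real
    assume *: "s \<in> dominated_forms" "s' \<in> dominated_forms" "0 \<le> t" "t \<le> 1"
    show "\<exists>w\<in>dominated_forms. \<forall>i\<in>I. \<phi> i w = (1 - t) * \<phi> i s + t * \<phi> i s'"
      by (rule bexI[OF _ dominated_forms_convex[OF *]]) (simp add: \<phi>_def algebra_simps)
  next
    fix l :: "'e \<times> 'f cdual \<Rightarrow> real" assume l: "\<And>i. i \<in> I \<Longrightarrow> 0 \<le> l i"
    define \<Psi> where "\<Psi> s = (\<Sum>i\<in>I. l i * Re (s (snd i, snd i)))"
      for s :: "'f cdual \<times> 'f cdual \<Rightarrow> complex"
    have "continuous_on dominated_forms \<Psi>"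
      unfolding \<Psi>_def
      by (intro continuous_intros continuous_on_subset[OF continuous_on_product_coordinates subset_UNIV])
    moreover have "dominated_forms \<noteq> ({} :: ('f cdual \<times> 'f cdual \<Rightarrow> complex) set)"
      using rank_one_dominated[of 0] by auto
    \<comment> \<open>A maximizer is needed, since the supremum in the weak norm need not be attained at a point mass.\<close>
    ultimately obtain k where k: "k \<in> dominated_forms" and max: "\<And>s. s \<in> dominated_forms \<Longrightarrow> \<Psi> s \<le> \<Psi> k"
      using continuous_attains_sup[OF compact_dominated_forms] by metis
    \<comment> \<open>The summing inequality speaks of families indexed by an initial segment, so the finite set is enumerated.\<close>
    obtain b where b: "bij_betw b {1..card I} I"
      using ex_bij_betw_nat_finite_1[OF fin] by blast
    have bI: "b j \<in> I" if "j \<in> {1..card I}" for j using b that by (auto simp: bij_betw_def)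
    define ys where "ys j = complex_of_real (sqrt (l (b j))) *\<^sub>C snd (b j)" for j
    define a where "a j = complex_of_real (sqrt (l (b j) * v (b j)))" for j
    define S where "S = (\<Sum>i\<in>I. l i * v i)"
    have v: "0 \<le> v i" for i by (simp add: v_def split: prod.split)
    have reindex: "(\<Sum>j=1..card I. g (b j)) = sum g I" for g :: "_ \<Rightarrow> real"
      by (rule sum.reindex_bij_betw[OF b])
    have S: "0 \<le> S" unfolding S_def using l v by (intro sum_nonneg) auto
    have "(\<Sum>j=1..card I. (cmod (a j))\<^sup>2) = (\<Sum>j=1..card I. l (b j) * v (b j))"
      using l v bI by (intro sum.cong refl) (simp add: a_def)
    then have aS: "(\<Sum>j=1..card I. (cmod (a j))\<^sup>2) = S"
      unfolding S_def using reindex[of "\<lambda>i. l i * v i"] by simp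
    have "(\<Sum>j=1..card I. cmod (a j) * cmod (cdual_apply (ys j) (f (fst (b j))))) =
        (\<Sum>j=1..card I. l (b j) * v (b j))"
    proof (intro sum.cong refl)
      fix j assume "j \<in> {1..card I}"
      then have lj: "0 \<le> l (b j)" using l bI by auto
      have vj: "sqrt (v (b j)) = cmod (cdual_apply (snd (b j)) (f (fst (b j))))"
        by (simp add: v_def split: prod.split)
      have "cmod (a j) * cmod (cdual_apply (ys j) (f (fst (b j)))) =
          (sqrt (l (b j)) * sqrt (l (b j))) * (sqrt (v (b j)) * sqrt (v (b j)))"
        using lj v[of "b j"]
        by (simp add: a_def ys_def cdual_apply_scaleC_left norm_mult real_sqrt_mult vj)
      then show "cmod (a j) * cmod (cdual_apply (ys j) (f (fst (b j)))) = l (b j) * v (b j)"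
        using lj v[of "b j"] by simp
    qed
    then have yS: "(\<Sum>j=1..card I. cmod (a j) * cmod (cdual_apply (ys j) (f (fst (b j))))) = S"
      unfolding S_def using reindex[of "\<lambda>i. l i * v i"] by simp
    have "\<forall>i\<in>{1..card I}. fst (b i) \<in> U" using bI IU by (metis mem_Times_iff subsetD)
    from summing[THEN spec, of "card I", THEN spec, of a, THEN spec, of "\<lambda>j. fst (b j)", THEN spec, of ys, THEN mp, OF this]
    have main: "S \<le> C * sqrt S * weak_l2_norm (card I) ys"
      unfolding aS yS .
    have w: "weak_l2_norm (card I) ys \<le> sqrt (\<Psi> k)"
      unfolding weak_l2_norm_def
    proof (rule cSUP_least)
      fix \<eta> :: "'f cdual cdual" assume \<eta>: "\<eta> \<in> cball 0 1"
      have "(\<Sum>j=1..card I. (cmod (cdual_apply \<eta> (ys j)))\<^sup>2) =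
          (\<Sum>j=1..card I. l (b j) * (cmod (cdual_apply \<eta> (snd (b j))))\<^sup>2)"
        using l bI by (intro sum.cong refl)
          (simp add: ys_def cdual_apply_scaleC_right norm_mult power_mult_distrib)
      also have "\<dots> = \<Psi> (\<lambda>(y, z). cdual_apply \<eta> y * cnj (cdual_apply \<eta> z))"
        unfolding \<Psi>_def prod.case Re_mult_cnj
        by (rule reindex[of "\<lambda>i. l i * (cmod (cdual_apply \<eta> (snd i)))\<^sup>2"])
      also have "\<dots> \<le> \<Psi> k" by (rule max[OF rank_one_dominated[OF \<eta>]])
      finally show "sqrt (\<Sum>j=1..card I. (cmod (cdual_apply \<eta> (ys j)))\<^sup>2) \<le> sqrt (\<Psi> k)"
        by (rule real_sqrt_le_mono)
    qed simp
    have \<Psi>k: "0 \<le> \<Psi> k"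
      unfolding \<Psi>_def using l k by (intro sum_nonneg mult_nonneg_nonneg) (simp_all add: dominated_forms_nonneg)
    have "S \<le> C\<^sup>2 * \<Psi> k"
    proof (cases "S = 0")
      case False
      have "sqrt S * sqrt S \<le> sqrt S * (C * sqrt (\<Psi> k))"
        using order_trans[OF main mult_left_mono[OF w, of "C * sqrt S"]] C S by (simp add: mult_ac)
      then have "sqrt S \<le> C * sqrt (\<Psi> k)" by (rule mult_left_le_imp_le) (use False S in simp)
      then have "(sqrt S)\<^sup>2 \<le> (C * sqrt (\<Psi> k))\<^sup>2" using S by (intro power_mono) auto
      then show ?thesis using S \<Psi>k by (simp add: power_mult_distrib)
    qed (use \<Psi>k in simp)
    moreover have "(\<Sum>i\<in>I. l i * \<phi> i k) = C\<^sup>2 * \<Psi> k - S"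
      unfolding \<phi>_def \<Psi>_def S_def sum_distrib_left sum_subtractf[symmetric]
      by (intro sum.cong refl) (simp add: algebra_simps)
    ultimately have "0 \<le> (\<Sum>i\<in>I. l i * \<phi> i k)" by linarith
    then show "\<exists>k\<in>dominated_forms. 0 \<le> (\<Sum>i\<in>I. l i * \<phi> i k)" using k by blast
  qed
  note finite = this
  have "dominated_forms \<inter> (\<Inter>i\<in>U \<times> UNIV. {s. 0 \<le> \<phi> i s}) \<noteq> {}"
  proof (rule compact_imp_fip_image[OF compact_dominated_forms])
    show "closed {s. 0 \<le> \<phi> i s}" for i
      by (rule closed_Collect_le[OF continuous_on_const cont])
    show "dominated_forms \<inter> (\<Inter>i\<in>I. {s. 0 \<le> \<phi> i s}) \<noteq> {}"
      if "finite I" "I \<subseteq> U \<times> UNIV" for I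
      using finite[OF that] by auto
  qed
  then obtain s where s: "s \<in> dominated_forms" "\<And>i. i \<in> U \<times> UNIV \<Longrightarrow> 0 \<le> \<phi> i s" by auto
  show ?thesis
  proof (intro bexI[OF _ s(1)] ballI allI)
    show "(cmod (cdual_apply y (f x)))\<^sup>2 \<le> C\<^sup>2 * Re (s (y, y))" if "x \<in> U" for x y
      using s(2)[of "(x, y)"] that by (simp add: \<phi>_def v_def)
  qed
qed

section \<open>Uniform Cauchy estimates for scalar slices\<close>

text \<open>Cauchy's inequality on discs of radius \<open>\<rho> / 4\<close> around points of the disc of radius \<open>\<rho> / 2\<close>
  bounds the first two derivatives; Taylor's formula turns the bound on the second into the
  estimate of the remainder at 1, which lies in the smaller disc when \<open>2 < \<rho>\<close>.\<close>

lemma Cauchy_first_order_estimates: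
  assumes holo: "\<phi> holomorphic_on ball 0 \<rho>" and \<rho>: "0 < \<rho>"
    and bound: "\<And>t. t \<in> ball 0 \<rho> \<Longrightarrow> cmod (\<phi> t) \<le> M"
  shows "cmod (deriv \<phi> 0) \<le> 4 * M / \<rho>"
    and "2 < \<rho> \<Longrightarrow> cmod (\<phi> 1 - \<phi> 0 - deriv \<phi> 0) \<le> 32 * M / \<rho>\<^sup>2"
proof -
  have est: "cmod ((deriv ^^ n) \<phi> u) \<le> fact n * M / (\<rho> / 4) ^ n" if u: "u \<in> ball 0 (\<rho> / 2)" for n u
  proof (rule Cauchy_inequality)
    have sub: "cball u (\<rho> / 4) \<subseteq> ball 0 \<rho>"
      using u \<rho> by (intro cball_subset_ball_iff[THEN iffD2]) (simp add: dist_commute)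
    then show "\<phi> holomorphic_on ball u (\<rho> / 4)"
      using ball_subset_cball holo holomorphic_on_subset by blast
    show "continuous_on (cball u (\<rho> / 4)) \<phi>"
      by (rule holomorphic_on_imp_continuous_on[OF holomorphic_on_subset[OF holo sub]])
    show "cmod (\<phi> x) \<le> M" if "cmod (u - x) = \<rho> / 4" for x
      using sub that by (intro bound) (auto simp: dist_norm)
  qed (use \<rho> in simp)
  show "cmod (deriv \<phi> 0) \<le> 4 * M / \<rho>"
    using est[of 0 1] \<rho> by (simp add: field_simps)
  assume \<rho>2: "2 < \<rho>"
  have "cmod ((deriv ^^ 0) \<phi> 1 - (\<Sum>i\<le>1. (deriv ^^ i) \<phi> 0 * (1 - 0) ^ i / fact i))
      \<le> 32 * M / \<rho>\<^sup>2 * cmod (1 - 0) ^ Suc 1 / fact 1"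
  proof (rule complex_Taylor)
    show "((deriv ^^ i) \<phi> has_field_derivative (deriv ^^ Suc i) \<phi> x) (at x within ball 0 (\<rho> / 2))"
      if "x \<in> ball 0 (\<rho> / 2)" for i x
    proof -
      have "(deriv ^^ i) \<phi> holomorphic_on ball 0 \<rho>"
        by (rule holomorphic_higher_deriv[OF holo open_ball])
      moreover have "x \<in> ball 0 \<rho>" using that \<rho> by simp
      ultimately have "((deriv ^^ i) \<phi> has_field_derivative deriv ((deriv ^^ i) \<phi>) x) (at x)"
        by (rule holomorphic_derivI[OF _ open_ball])
      then show ?thesis by (simp add: has_field_derivative_at_within)
    qed
    show "cmod ((deriv ^^ Suc 1) \<phi> x) \<le> 32 * M / \<rho>\<^sup>2" if "x \<in> ball 0 (\<rho> / 2)" for x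
      using est[OF that, of "Suc 1"] by (simp add: power2_eq_square)
  qed (use \<rho>2 in auto)
  then show "cmod (\<phi> 1 - \<phi> 0 - deriv \<phi> 0) \<le> 32 * M / \<rho>\<^sup>2"
    by (simp add: diff_diff_eq)
qed

text \<open>The scalar estimates for \<open>t \<mapsto> y (f (x + t v))\<close> on the disc of radius \<open>r / \<parallel>v\<parallel>\<close>. Both bounds are
  linear in the bound \<open>M\<close> of \<open>y \<circ> f\<close>: when \<open>M\<close> is a multiple of a seminorm of \<open>y\<close>, they hold in the
  dual norm of that seminorm.\<close>

lemma weak_Cauchy_estimates:
  fixes f :: "'e::complex_normed_vector \<Rightarrow> 'f::complex_normed_vector"
  assumes r: "0 < r"
    and der: "\<And>u. u \<in> ball x r \<Longrightarrow> (f has_derivative D u) (at u)"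
    and lin: "\<And>u c h. u \<in> ball x r \<Longrightarrow> D u (c *\<^sub>C h) = c *\<^sub>C D u h"
    and bound: "\<And>u. u \<in> ball x r \<Longrightarrow> cmod (cdual_apply y (f u)) \<le> M"
  shows "cmod (cdual_apply y (D x v)) \<le> 4 * M / r * norm v"
    and "norm v < r / 2 \<Longrightarrow>
      cmod (cdual_apply y (f (x + v) - f x - D x v)) \<le> 32 * M / r\<^sup>2 * (norm v)\<^sup>2"
proof -
  have "cmod (cdual_apply y (D x v)) \<le> 4 * M / r * norm v \<and> (norm v < r / 2 \<longrightarrow>
      cmod (cdual_apply y (f (x + v) - f x - D x v)) \<le> 32 * M / r\<^sup>2 * (norm v)\<^sup>2)"
  proof (cases "v = 0")
    case True
    have "D x 0 = 0" using der[of x] r by (simp add: has_derivative_bounded_linear linear_simps)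
    then show ?thesis using True by (simp add: linear_0[OF bounded_linear.linear[OF bounded_linear_cdual_apply]])
  next
    case False
    define \<rho> where "\<rho> = r / norm v"
    define \<phi> where "\<phi> t = cdual_apply y (f (x + t *\<^sub>C v))" for t
    have \<rho>: "0 < \<rho>" using r False by (simp add: \<rho>_def)
    have inball: "x + t *\<^sub>C v \<in> ball x r" if "t \<in> ball 0 \<rho>" for t
      using that False by (simp add: \<rho>_def dist_norm norm_scaleC pos_less_divide_eq)
    have line: "((\<lambda>t. x + t *\<^sub>C v) has_derivative (\<lambda>h. h *\<^sub>C v)) (at t)" for t
    proof -
      have "bounded_linear (\<lambda>h. h *\<^sub>C v)"
        by (rule bounded_linear_intro[where K = "norm v"])
          (simp_all add: scaleC_add_left norm_scaleC scaleR_scaleC scaleC_scaleC scaleR_conv_of_real)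
      then have "((\<lambda>t. t *\<^sub>C v) has_derivative (\<lambda>h. h *\<^sub>C v)) (at t)"
        by (rule bounded_linear_imp_has_derivative)
      then show ?thesis by (auto intro!: derivative_eq_intros)
    qed
    have dphi: "(\<phi> has_field_derivative cdual_apply y (D (x + t *\<^sub>C v) v)) (at t)"
      if t: "t \<in> ball 0 \<rho>" for t
    proof -
      have "((\<lambda>t. f (x + t *\<^sub>C v)) has_derivative (\<lambda>h. D (x + t *\<^sub>C v) (h *\<^sub>C v))) (at t)"
        by (rule has_derivative_compose[OF line der[OF inball[OF t]]])
      then have "(\<phi> has_derivative (\<lambda>h. cdual_apply y (D (x + t *\<^sub>C v) (h *\<^sub>C v)))) (at t)"
        unfolding \<phi>_def by (rule bounded_linear.has_derivative[OF bounded_linear_cdual_apply])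
      then show ?thesis
        by (simp add: has_field_derivative_def lin[OF inball[OF t]] cdual_apply_scaleC_right
            mult.commute[of _ "cdual_apply y (D (x + t *\<^sub>C v) v)"])
    qed
    have "\<phi> holomorphic_on ball 0 \<rho>"
      unfolding holomorphic_on_open[OF open_ball] using dphi by blast
    note est = Cauchy_first_order_estimates[OF this \<rho>, of M]
    have M: "cmod (\<phi> t) \<le> M" if "t \<in> ball 0 \<rho>" for t
      unfolding \<phi>_def by (rule bound[OF inball[OF that]])
    have d0: "deriv \<phi> 0 = cdual_apply y (D x v)"
      using DERIV_imp_deriv[OF dphi[of 0]] \<rho> by (simp add: scaleC_zero_left)
    have "2 < \<rho>" if "norm v < r / 2"
      using that False by (simp add: \<rho>_def field_simps)
    then show ?thesis
      using est[OF M] d0 False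
      by (simp add: \<rho>_def \<phi>_def cdual_apply_diff_right scaleC_zero_left power_divide)
  qed
  then show "cmod (cdual_apply y (D x v)) \<le> 4 * M / r * norm v"
    and "norm v < r / 2 \<Longrightarrow>
      cmod (cdual_apply y (f (x + v) - f x - D x v)) \<le> 32 * M / r\<^sup>2 * (norm v)\<^sup>2" by auto
qed

section \<open>The Hilbert space of a dominated form\<close>

text \<open>The common core of the Cauchy-Schwarz inequality and of the Riesz representation: minimize
  over \<open>t\<close> on the ray through \<open>- cnj \<sigma>\<close>.\<close>

lemma complex_discriminant:
  assumes nonneg: "\<And>t. 0 \<le> A + 2 * Re (t * \<sigma>) + (cmod t)\<^sup>2 * B" and A: "0 \<le> A" and B: "0 \<le> B"
  shows "(cmod \<sigma>)\<^sup>2 \<le> A * B"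
proof -
  have *: "0 \<le> A - 2 * r * (cmod \<sigma>)\<^sup>2 + r\<^sup>2 * (cmod \<sigma>)\<^sup>2 * B" for r :: real
  proof -
    have "Re (- complex_of_real r * cnj \<sigma> * \<sigma>) = - r * (cmod \<sigma>)\<^sup>2"
      unfolding cmod_power2 by (simp add: power2_eq_square algebra_simps)
    then show ?thesis
      using nonneg[of "- complex_of_real r * cnj \<sigma>"] by (simp add: norm_mult power_mult_distrib)
  qed
  show ?thesis
  proof (cases "B = 0")
    case True
    have "\<sigma> = 0"
    proof (rule ccontr)
      assume "\<sigma> \<noteq> 0"
      then show False using *[of "(A + 1) / (cmod \<sigma>)\<^sup>2"] True A by simp
    qed
    then show ?thesis using True by simp
  next
    case False
    then have "0 \<le> A - (cmod \<sigma>)\<^sup>2 / B"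
      using *[of "1 / B"] by (simp add: power2_eq_square field_simps)
    then show ?thesis using False B by (simp add: field_simps)
  qed
qed

lemma le_if_power2_le: "0 \<le> a \<Longrightarrow> (a::real)\<^sup>2 \<le> b * a \<Longrightarrow> 0 \<le> b \<Longrightarrow> a \<le> b"
  by (cases "a = 0") (auto simp: power2_eq_square)

locale dominated_form =
  fixes s :: "'f::complex_normed_vector cdual \<times> 'f cdual \<Rightarrow> complex"
  assumes dominated: "s \<in> dominated_forms"
begin

lemmas s_add_left = dominated_forms_add[OF dominated]
lemmas s_scaleC_left = dominated_forms_scale[OF dominated]
lemmas s_hermitian = dominated_forms_hermitian[OF dominated]

lemma s_add_right: "s (y, z + z') = s (y, z) + s (y, z')"
  using s_hermitian[of y "z + z'"] s_hermitian[of y z] s_hermitian[of y z'] by (simp add: s_add_left)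

lemma s_scaleC_right: "s (y, c *\<^sub>C z) = cnj c * s (y, z)"
  using s_hermitian[of y "c *\<^sub>C z"] s_hermitian[of y z] by (simp add: s_scaleC_left)

lemma s_diff_right: "s (y, z - z') = s (y, z) - s (y, z')"
  using s_add_right[of y "z - z'" z'] by simp

definition form_norm :: "'f cdual \<Rightarrow> real" where
  "form_norm y = sqrt (Re (s (y, y)))"

lemma form_norm_nonneg: "0 \<le> form_norm y"
  by (simp add: form_norm_def dominated_forms_nonneg[OF dominated])

lemma form_norm_power2: "(form_norm y)\<^sup>2 = Re (s (y, y))"
  by (simp add: form_norm_def dominated_forms_nonneg[OF dominated])

lemma s_self: "s (y, y) = complex_of_real ((form_norm y)\<^sup>2)"
proof -
  have "Im (s (y, y)) = - Im (s (y, y))"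
    using arg_cong[OF s_hermitian[of y y], of Im] unfolding cnj.simps .
  then show ?thesis by (simp add: form_norm_power2 complex_eq_iff)
qed

lemma form_norm_le_norm: "form_norm y \<le> norm y"
proof -
  have "(form_norm y)\<^sup>2 \<le> (norm y)\<^sup>2"
    using dominated_forms_bound[OF dominated, of y y] complex_Re_le_cmod[of "s (y, y)"]
    unfolding form_norm_power2 power2_eq_square[of "norm y"] by linarith
  then show ?thesis by (rule power2_le_imp_le) simp
qed

lemma form_norm_power2_expand: "(form_norm (y + t *\<^sub>C z))\<^sup>2 = (form_norm y)\<^sup>2 + 2 * Re (t * s (z, y)) + (cmod t)\<^sup>2 * (form_norm z)\<^sup>2"
proof -
  have "Re (cnj t * s (y, z)) = Re (t * s (z, y))"
    using s_hermitian[of y z] by simp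
  moreover have "Re (t * (cnj t * s (z, z))) = (cmod t)\<^sup>2 * (form_norm z)\<^sup>2"
    unfolding s_self cmod_power2 by (simp add: power2_eq_square algebra_simps)
  moreover have "s (y + t *\<^sub>C z, y + t *\<^sub>C z) =
      s (y, y) + cnj t * s (y, z) + t * s (z, y) + t * (cnj t * s (z, z))"
    by (simp add: s_add_left s_add_right s_scaleC_left s_scaleC_right algebra_simps)
  ultimately show ?thesis
    unfolding form_norm_power2[of "y + t *\<^sub>C z"] form_norm_power2[of y] by simp
qed

lemma Cauchy_Schwarz: "cmod (s (z, y)) \<le> form_norm z * form_norm y"
proof -
  have "(cmod (s (z, y)))\<^sup>2 \<le> (form_norm y)\<^sup>2 * (form_norm z)\<^sup>2"
  proof (rule complex_discriminant)
    show "0 \<le> (form_norm y)\<^sup>2 + 2 * Re (t * s (z, y)) + (cmod t)\<^sup>2 * (form_norm z)\<^sup>2" for t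
      unfolding form_norm_power2_expand[symmetric] by (rule zero_le_power2)
  qed simp_all
  then have "(cmod (s (z, y)))\<^sup>2 \<le> (form_norm z * form_norm y)\<^sup>2" by (simp add: power_mult_distrib mult.commute)
  then show ?thesis by (rule power2_le_imp_le) (simp add: form_norm_nonneg)
qed

text \<open>The dual of the pre-Hilbert space \<open>(F\<^sup>*, form_norm)\<close>, cut down to the functionals that are
  evaluations at points of \<open>F\<close> and identified with these points, so that the type of \<open>F\<close> can carry it.\<close>

definition form_dual :: "'f set" where
  "form_dual = {h. \<exists>K\<ge>0. \<forall>y. cmod (cdual_apply y h) \<le> K * form_norm y}"

definition dual_norm :: "'f \<Rightarrow> real" where
  "dual_norm h = Inf {K. 0 \<le> K \<and> (\<forall>y. cmod (cdual_apply y h) \<le> K * form_norm y)}"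

lemma form_dualI: "0 \<le> K \<Longrightarrow> (\<And>y. cmod (cdual_apply y h) \<le> K * form_norm y) \<Longrightarrow> h \<in> form_dual"
  by (auto simp: form_dual_def)

lemma dual_norm_le: "0 \<le> K \<Longrightarrow> (\<And>y. cmod (cdual_apply y h) \<le> K * form_norm y) \<Longrightarrow> dual_norm h \<le> K"
  unfolding dual_norm_def by (rule cInf_lower) (auto intro: bdd_belowI)

lemma dual_norm_nonneg: "h \<in> form_dual \<Longrightarrow> 0 \<le> dual_norm h"
  unfolding dual_norm_def form_dual_def by (rule cInf_greatest) auto

lemma cdual_apply_le_dual_norm:
  assumes h: "h \<in> form_dual"
  shows "cmod (cdual_apply y h) \<le> dual_norm h * form_norm y"
proof (cases "form_norm y = 0")
  case True
  obtain K where "\<And>y. cmod (cdual_apply y h) \<le> K * form_norm y" using h by (auto simp: form_dual_def)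
  from this[of y] True show ?thesis by simp
next
  case False
  then have qpos: "0 < form_norm y" using form_norm_nonneg[of y] by simp
  have "cmod (cdual_apply y h) / form_norm y \<le> dual_norm h"
    unfolding dual_norm_def using h qpos by (intro cInf_greatest) (auto simp: form_dual_def pos_divide_le_eq)
  then show ?thesis using qpos by (simp add: pos_divide_le_eq)
qed

lemma zero_form_dual: "0 \<in> form_dual"
  using linear_0[OF bounded_linear.linear[OF bounded_linear_cdual_apply]] by (intro form_dualI[of 0]) auto

lemma
  assumes h: "h \<in> form_dual" and k: "k \<in> form_dual"
  shows add_form_dual: "h + k \<in> form_dual" and dual_norm_add: "dual_norm (h + k) \<le> dual_norm h + dual_norm k"
proof -
  have "cmod (cdual_apply y (h + k)) \<le> (dual_norm h + dual_norm k) * form_norm y" for y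
    using norm_triangle_ineq[of "cdual_apply y h" "cdual_apply y k"]
      cdual_apply_le_dual_norm[OF h, of y] cdual_apply_le_dual_norm[OF k, of y]
    by (simp add: cdual_apply_add_right algebra_simps)
  moreover have "0 \<le> dual_norm h + dual_norm k" using dual_norm_nonneg h k by simp
  ultimately show "h + k \<in> form_dual" "dual_norm (h + k) \<le> dual_norm h + dual_norm k" by (auto intro: form_dualI dual_norm_le)
qed

lemma
  assumes h: "h \<in> form_dual"
  shows scaleC_form_dual: "c *\<^sub>C h \<in> form_dual" and dual_norm_scaleC_le: "dual_norm (c *\<^sub>C h) \<le> cmod c * dual_norm h"
proof -
  have "cmod (cdual_apply y (c *\<^sub>C h)) \<le> (cmod c * dual_norm h) * form_norm y" for y
    using cdual_apply_le_dual_norm[OF h, of y]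
    by (simp add: cdual_apply_scaleC_right norm_mult mult.assoc mult_left_mono)
  moreover have "0 \<le> cmod c * dual_norm h" using dual_norm_nonneg h by simp
  ultimately show "c *\<^sub>C h \<in> form_dual" "dual_norm (c *\<^sub>C h) \<le> cmod c * dual_norm h" by (auto intro: form_dualI dual_norm_le)
qed

lemma diff_form_dual: "h \<in> form_dual \<Longrightarrow> k \<in> form_dual \<Longrightarrow> h - k \<in> form_dual"
  using add_form_dual[of h "(- 1) *\<^sub>C k"] scaleC_form_dual[of k "- 1"] by (simp add: scaleC_minus_one)

text \<open>This is where separation of points by the dual enters. It makes \<open>dual_norm\<close> definite and the
  inclusion into \<open>F\<close> continuous, and it reduces completeness to that of \<open>F\<close>.\<close>

lemma norm_le_dual_norm:
  assumes h: "h \<in> form_dual"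
  shows "norm h \<le> 2 * dual_norm h"
proof -
  obtain y :: "'f cdual" where y: "norm y \<le> 2" "norm h \<le> cmod (cdual_apply y h)"
    using cdual_almost_norming[of h] by blast
  have "dual_norm h * form_norm y \<le> dual_norm h * 2"
    using form_norm_le_norm[of y] y dual_norm_nonneg[OF h] by (intro mult_left_mono) auto
  then show ?thesis using y cdual_apply_le_dual_norm[OF h, of y] by simp
qed

lemma dual_norm_eq_0_iff: "h \<in> form_dual \<Longrightarrow> dual_norm h = 0 \<longleftrightarrow> h = 0"
  using norm_le_dual_norm[of h] dual_norm_le[of 0 0] dual_norm_nonneg[OF zero_form_dual]
    linear_0[OF bounded_linear.linear[OF bounded_linear_cdual_apply]] by force

lemma dual_norm_scaleC:
  assumes h: "h \<in> form_dual"
  shows "dual_norm (c *\<^sub>C h) = cmod c * dual_norm h"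
proof (cases "c = 0")
  case True
  then show ?thesis using dual_norm_eq_0_iff[OF zero_form_dual] by (simp add: scaleC_zero_left)
next
  case False
  have "cmod c * dual_norm h \<le> cmod c * (cmod (inverse c) * dual_norm (c *\<^sub>C h))"
    using dual_norm_scaleC_le[OF scaleC_form_dual[OF h], of "inverse c" c] False
    by (intro mult_left_mono) (simp_all add: scaleC_scaleC)
  also have "\<dots> = dual_norm (c *\<^sub>C h)" using False by (simp add: norm_inverse)
  finally show ?thesis using dual_norm_scaleC_le[OF h, of c] by simp
qed

text \<open>Near-minimizers \<open>y\<close> of \<open>q(y)\<^sup>2 - 2 Re y(h)\<close> almost represent \<open>h\<close>: moving from \<open>y\<close> to \<open>y + t z\<close> can
  lower the value by less than \<open>e\<^sup>2\<close>, and the discriminant of this quadratic expression in \<open>t\<close>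
  gives the bound. Exact representers would live only in the completion of \<open>(F\<^sup>*, q)\<close>.\<close>

lemma approximate_Riesz:
  assumes h: "h \<in> form_dual" and e: "0 < e"
  obtains y where "\<And>z. cmod (cdual_apply z h - s (z, y)) \<le> e * form_norm z"
proof -
  define J where "J y = (form_norm y)\<^sup>2 - 2 * Re (cdual_apply y h)" for y
  have "- (dual_norm h)\<^sup>2 \<le> J y" for y
  proof -
    have "Re (cdual_apply y h) \<le> dual_norm h * form_norm y"
      using complex_Re_le_cmod[of "cdual_apply y h"] cdual_apply_le_dual_norm[OF h, of y] by linarith
    moreover have "0 \<le> (form_norm y - dual_norm h)\<^sup>2" by simp
    ultimately show ?thesis by (simp add: J_def power2_eq_square algebra_simps)
  qed
  then have bdd: "bdd_below (range J)" by (intro bdd_belowI2[of UNIV "- (dual_norm h)\<^sup>2"])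
  have "Inf (range J) < Inf (range J) + e\<^sup>2" using e by simp
  then obtain y where y: "J y < Inf (range J) + e\<^sup>2"
    using cInf_less_iff[OF _ bdd, of "Inf (range J) + e\<^sup>2"] by auto
  have "cmod (cdual_apply z h - s (z, y)) \<le> e * form_norm z" for z
  proof -
    have "(cmod (s (z, y) - cdual_apply z h))\<^sup>2 \<le> e\<^sup>2 * (form_norm z)\<^sup>2"
    proof (rule complex_discriminant)
      fix t
      have "Inf (range J) \<le> J (y + t *\<^sub>C z)" by (intro cInf_lower bdd) auto
      also have "\<dots> = J y + 2 * Re (t * (s (z, y) - cdual_apply z h)) + (cmod t)\<^sup>2 * (form_norm z)\<^sup>2"
        unfolding J_def form_norm_power2_expand cdual_apply_add_left cdual_apply_scaleC_left
        by (simp add: algebra_simps)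
      finally show "0 \<le> e\<^sup>2 + 2 * Re (t * (s (z, y) - cdual_apply z h)) + (cmod t)\<^sup>2 * (form_norm z)\<^sup>2"
        using y by simp
    qed simp_all
    then have "(cmod (cdual_apply z h - s (z, y)))\<^sup>2 \<le> (e * form_norm z)\<^sup>2"
      by (simp add: norm_minus_commute power_mult_distrib)
    then show ?thesis by (rule power2_le_imp_le) (use e form_norm_nonneg in simp)
  qed
  then show ?thesis by (rule that)
qed

definition riesz_seq :: "'f \<Rightarrow> nat \<Rightarrow> 'f cdual" where
  "riesz_seq h n = (SOME y. \<forall>z. cmod (cdual_apply z h - s (z, y)) \<le> inverse (real (Suc n)) * form_norm z)"

lemma riesz_seq_approx:
  assumes h: "h \<in> form_dual"
  shows "cmod (cdual_apply z h - s (z, riesz_seq h n)) \<le> inverse (real (Suc n)) * form_norm z"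
proof -
  have "0 < inverse (real (Suc n))" by simp
  then obtain y where "\<And>z. cmod (cdual_apply z h - s (z, y)) \<le> inverse (real (Suc n)) * form_norm z"
    using approximate_Riesz[OF h] by blast
  then have "\<exists>y. \<forall>z. cmod (cdual_apply z h - s (z, y)) \<le> inverse (real (Suc n)) * form_norm z" by blast
  from someI_ex[OF this] show ?thesis unfolding riesz_seq_def by blast
qed

lemma form_norm_riesz_seq_le:
  assumes h: "h \<in> form_dual"
  shows "form_norm (riesz_seq h n) \<le> dual_norm h + inverse (real (Suc n))"
proof (rule le_if_power2_le[OF form_norm_nonneg])
  let ?y = "riesz_seq h n"
  have "(form_norm ?y)\<^sup>2 = cmod (s (?y, ?y))" unfolding s_self norm_of_real by simp
  also have "\<dots> \<le> cmod (cdual_apply ?y h) + cmod (cdual_apply ?y h - s (?y, ?y))"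
    using norm_triangle_ineq4[of "cdual_apply ?y h" "cdual_apply ?y h - s (?y, ?y)"] by simp
  also have "\<dots> \<le> (dual_norm h + inverse (real (Suc n))) * form_norm ?y"
    using cdual_apply_le_dual_norm[OF h, of ?y] riesz_seq_approx[OF h, of ?y n] by (simp add: distrib_right)
  finally show "(form_norm ?y)\<^sup>2 \<le> (dual_norm h + inverse (real (Suc n))) * form_norm ?y" .
qed (use dual_norm_nonneg[OF h] in simp)

lemma dual_norm_le_riesz_seq:
  assumes h: "h \<in> form_dual"
  shows "dual_norm h \<le> form_norm (riesz_seq h n) + inverse (real (Suc n))"
proof (rule dual_norm_le)
  fix z
  have "cmod (cdual_apply z h) \<le> cmod (s (z, riesz_seq h n)) + cmod (cdual_apply z h - s (z, riesz_seq h n))"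
    using norm_triangle_ineq[of "s (z, riesz_seq h n)" "cdual_apply z h - s (z, riesz_seq h n)"] by simp
  also have "\<dots> \<le> (form_norm (riesz_seq h n) + inverse (real (Suc n))) * form_norm z"
    using Cauchy_Schwarz[of z "riesz_seq h n"] riesz_seq_approx[OF h, of z n]
    unfolding distrib_right mult.commute[of "form_norm (riesz_seq h n)"] by linarith
  finally show "cmod (cdual_apply z h) \<le> (form_norm (riesz_seq h n) + inverse (real (Suc n))) * form_norm z" .
qed (simp add: form_norm_nonneg)

lemma form_norm_riesz_seq_tendsto:
  assumes h: "h \<in> form_dual"
  shows "(\<lambda>n. form_norm (riesz_seq h n)) \<longlonglongrightarrow> dual_norm h"
proof (rule LIM_zero_cancel, rule Lim_null_comparison[OF always_eventually LIMSEQ_inverse_real_of_nat], rule allI)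
  show "norm (form_norm (riesz_seq h n) - dual_norm h) \<le> inverse (real (Suc n))" for n
    using form_norm_riesz_seq_le[OF h, of n] dual_norm_le_riesz_seq[OF h, of n] by (simp add: abs_le_iff)
qed

lemma form_norm_riesz_seq_diff:
  assumes h: "h \<in> form_dual"
  shows "form_norm (riesz_seq h n - riesz_seq h m) \<le> inverse (real (Suc n)) + inverse (real (Suc m))"
proof (rule le_if_power2_le[OF form_norm_nonneg])
  let ?y = "riesz_seq h n - riesz_seq h m"
  have "(form_norm ?y)\<^sup>2 = cmod (s (?y, ?y))" unfolding s_self norm_of_real by simp
  also have "\<dots> = cmod ((cdual_apply ?y h - s (?y, riesz_seq h m)) - (cdual_apply ?y h - s (?y, riesz_seq h n)))"
    by (simp add: s_diff_right)
  also have "\<dots> \<le> (inverse (real (Suc n)) + inverse (real (Suc m))) * form_norm ?y"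
    using norm_triangle_ineq4[of "cdual_apply ?y h - s (?y, riesz_seq h m)" "cdual_apply ?y h - s (?y, riesz_seq h n)"]
      riesz_seq_approx[OF h, of ?y n] riesz_seq_approx[OF h, of ?y m] by (simp add: distrib_right)
  finally show "(form_norm ?y)\<^sup>2 \<le> (inverse (real (Suc n)) + inverse (real (Suc m))) * form_norm ?y" .
qed simp

text \<open>A functional \<open>y\<close> represents the vector \<open>j(y)\<close> with \<open>z(j(y)) = s(z, y)\<close>, and pairing \<open>h\<close> with \<open>j(y)\<close> gives
  \<open>y(h)\<close>. The inner product with a general \<open>k\<close> is the limit of these values along approximate
  representers of \<open>k\<close>, which makes linearity in \<open>h\<close> evident.\<close>

definition dual_ip :: "'f \<Rightarrow> 'f \<Rightarrow> complex" where
  "dual_ip h k = lim (\<lambda>n. cdual_apply (riesz_seq k n) h)"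

lemma dual_ip_tendsto:
  assumes h: "h \<in> form_dual" and k: "k \<in> form_dual"
  shows "(\<lambda>n. cdual_apply (riesz_seq k n) h) \<longlonglongrightarrow> dual_ip h k"
proof -
  have "Cauchy (\<lambda>n. cdual_apply (riesz_seq k n) h)"
  proof (rule CauchyI)
    fix e :: real assume e: "0 < e"
    have "(\<lambda>n. dual_norm h * (2 * inverse (real (Suc n)))) \<longlonglongrightarrow> dual_norm h * (2 * 0)"
      by (intro tendsto_intros LIMSEQ_inverse_real_of_nat)
    then have "eventually (\<lambda>n. dual_norm h * (2 * inverse (real (Suc n))) < e) sequentially"
      using e by (intro order_tendstoD(2)) auto
    then obtain M where M: "dual_norm h * (2 * inverse (real (Suc M))) < e"
      by (auto simp: eventually_sequentially)
    show "\<exists>M. \<forall>m\<ge>M. \<forall>n\<ge>M. cmod (cdual_apply (riesz_seq k m) h - cdual_apply (riesz_seq k n) h) < e"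
    proof (intro exI allI impI)
      fix m n assume mn: "M \<le> m" "M \<le> n"
      have "cmod (cdual_apply (riesz_seq k m) h - cdual_apply (riesz_seq k n) h) \<le> dual_norm h * form_norm (riesz_seq k m - riesz_seq k n)"
        using cdual_apply_le_dual_norm[OF h, of "riesz_seq k m - riesz_seq k n"] by (simp add: cdual_apply_diff_left)
      also have "form_norm (riesz_seq k m - riesz_seq k n) \<le> inverse (real (Suc M)) + inverse (real (Suc M))"
        using mn by (intro order_trans[OF form_norm_riesz_seq_diff[OF k]] add_mono le_imp_inverse_le) auto
      then have "dual_norm h * form_norm (riesz_seq k m - riesz_seq k n) \<le> dual_norm h * (2 * inverse (real (Suc M)))"
        using dual_norm_nonneg[OF h] by (intro mult_left_mono) auto
      finally show "cmod (cdual_apply (riesz_seq k m) h - cdual_apply (riesz_seq k n) h) < e" using M by simp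
    qed
  qed
  then show ?thesis
    unfolding dual_ip_def by (simp add: Cauchy_convergent_iff convergent_LIMSEQ_iff)
qed

text \<open>Replacing \<open>h\<close> by its approximate representers as well makes the inner product symmetric in its
  two arguments: Hermitian symmetry and the value on the diagonal are read off from this form of it.\<close>

lemma form_riesz_seq_tendsto:
  assumes h: "h \<in> form_dual" and k: "k \<in> form_dual"
  shows "(\<lambda>n. s (riesz_seq k n, riesz_seq h n)) \<longlonglongrightarrow> dual_ip h k"
proof -
  have "(\<lambda>n. cdual_apply (riesz_seq k n) h - s (riesz_seq k n, riesz_seq h n)) \<longlonglongrightarrow> 0"
  proof (rule Lim_null_comparison[OF always_eventually], rule allI)
    show "cmod (cdual_apply (riesz_seq k n) h - s (riesz_seq k n, riesz_seq h n)) \<le> inverse (real (Suc n)) * form_norm (riesz_seq k n)" for n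
      by (rule riesz_seq_approx[OF h])
    show "(\<lambda>n. inverse (real (Suc n)) * form_norm (riesz_seq k n)) \<longlonglongrightarrow> 0"
      using tendsto_mult[OF LIMSEQ_inverse_real_of_nat form_norm_riesz_seq_tendsto[OF k]] by simp
  qed
  from tendsto_diff[OF dual_ip_tendsto[OF h k] this] show ?thesis by simp
qed

lemma dual_ip_commute:
  assumes h: "h \<in> form_dual" and k: "k \<in> form_dual"
  shows "dual_ip h k = cnj (dual_ip k h)"
proof -
  have "(\<lambda>n. cnj (s (riesz_seq h n, riesz_seq k n))) \<longlonglongrightarrow> cnj (dual_ip k h)"
    by (intro tendsto_cnj form_riesz_seq_tendsto h k)
  then have "(\<lambda>n. s (riesz_seq k n, riesz_seq h n)) \<longlonglongrightarrow> cnj (dual_ip k h)"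
    by (simp only: s_hermitian[symmetric])
  then show ?thesis using form_riesz_seq_tendsto[OF h k] LIMSEQ_unique by blast
qed

lemma dual_ip_self:
  assumes h: "h \<in> form_dual"
  shows "dual_ip h h = complex_of_real ((dual_norm h)\<^sup>2)"
proof -
  have "(\<lambda>n. complex_of_real ((form_norm (riesz_seq h n))\<^sup>2)) \<longlonglongrightarrow> complex_of_real ((dual_norm h)\<^sup>2)"
    by (intro tendsto_of_real tendsto_power form_norm_riesz_seq_tendsto h)
  then show ?thesis using form_riesz_seq_tendsto[OF h h] unfolding s_self by (rule LIMSEQ_unique[rotated])
qed

lemma dual_ip_add:
  assumes "h \<in> form_dual" "h' \<in> form_dual" "k \<in> form_dual"
  shows "dual_ip (h + h') k = dual_ip h k + dual_ip h' k"
  using dual_ip_tendsto[OF add_form_dual[OF assms(1,2)] assms(3)]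
    tendsto_add[OF dual_ip_tendsto[OF assms(1,3)] dual_ip_tendsto[OF assms(2,3)]]
  unfolding cdual_apply_add_right by (rule LIMSEQ_unique)

lemma dual_ip_scaleC:
  assumes "h \<in> form_dual" "k \<in> form_dual"
  shows "dual_ip (c *\<^sub>C h) k = c * dual_ip h k"
  using dual_ip_tendsto[OF scaleC_form_dual[OF assms(1)] assms(2)] tendsto_mult_left[OF dual_ip_tendsto[OF assms]]
  unfolding cdual_apply_scaleC_right by (rule LIMSEQ_unique)

definition dual_hilbert :: "'f cinner_space" where
  "dual_hilbert = \<lparr>carrier = form_dual, mult = undefined, one = undefined, zero = 0, add = (+), smult = scaleC,
    nrm = dual_norm, cinner = dual_ip\<rparr>"

lemma dual_hilbert_simps:
  "carrier dual_hilbert = form_dual" "\<zero>\<^bsub>dual_hilbert\<^esub> = 0"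
  "x \<oplus>\<^bsub>dual_hilbert\<^esub> y = x + y" "c \<odot>\<^bsub>dual_hilbert\<^esub> x = c *\<^sub>C x"
  "nrm dual_hilbert x = dual_norm x" "cinner dual_hilbert x y = dual_ip x y"
  by (simp_all add: dual_hilbert_def)

lemma complex_normed_space_dual_hilbert: "complex_normed_space dual_hilbert"
proof -
  interpret univ: complex_normed_space "univ_space :: 'f cnormed_space"
    by (rule complex_normed_space_univ_space)
  have minus: "- x \<in> form_dual" if "x \<in> form_dual" for x
    using diff_form_dual[OF zero_form_dual that] by simp
  have ag: "abelian_group dual_hilbert"
    by (rule abelian_groupI) (auto simp: dual_hilbert_simps zero_form_dual add_form_dual algebra_simps intro: bexI[OF _ minus])
  have "Module.module complex_ring dual_hilbert"
    by (rule moduleI[OF univ.R.is_cring ag])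
      (auto simp: dual_hilbert_simps complex_ring_def scaleC_form_dual scaleC_add_left scaleC_add_right scaleC_scaleC)
  then show ?thesis
    by (rule complex_normed_space.intro, unfold_locales)
      (auto simp: dual_hilbert_simps dual_norm_nonneg dual_norm_eq_0_iff dual_norm_scaleC dual_norm_add)
qed

lemma a_minus_dual_hilbert:
  assumes "x \<in> form_dual" "y \<in> form_dual"
  shows "x \<ominus>\<^bsub>dual_hilbert\<^esub> y = x - y"
proof -
  interpret complex_normed_space dual_hilbert by (rule complex_normed_space_dual_hilbert)
  have "\<ominus>\<^bsub>dual_hilbert\<^esub> y = - y"
    using assms diff_form_dual[OF zero_form_dual assms(2)] by (intro minus_equality) (auto simp: dual_hilbert_simps)
  then show ?thesis by (simp add: a_minus_def dual_hilbert_simps)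
qed

text \<open>The bound \<open>|y\<^sub>i(x\<^sub>i)| \<le> dual_norm(x\<^sub>i) q(y\<^sub>i)\<close> and the Cauchy-Schwarz inequality for sums leave
  \<open>\<Sum> q(y\<^sub>i)\<^sup>2\<close>, which the form keeps below the squared weak \<open>l\<^sub>2\<close> norm.\<close>

lemma strongly_2_summing_inclusion:
  "(\<lambda>x. x) \<in> strongly_2_summing_operators dual_hilbert"
proof -
  have "(\<Sum>i=1..n. cmod (cdual_apply (ys i) (x i)))
      \<le> sqrt (\<Sum>i=1..n. (dual_norm (x i))\<^sup>2) * weak_l2_norm n ys"
    if x: "\<forall>i\<in>{1..n}. x i \<in> form_dual" for n x ys
  proof -
    have "(\<Sum>i=1..n. cmod (cdual_apply (ys i) (x i))) \<le> (\<Sum>i=1..n. \<bar>dual_norm (x i)\<bar> * \<bar>form_norm (ys i)\<bar>)"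
      using x by (intro sum_mono) (simp add: cdual_apply_le_dual_norm dual_norm_nonneg form_norm_nonneg)
    also have "\<dots> \<le> L2_set (\<lambda>i. dual_norm (x i)) {1..n} * L2_set (\<lambda>i. form_norm (ys i)) {1..n}"
      by (rule L2_set_mult_ineq)
    also have "L2_set (\<lambda>i. form_norm (ys i)) {1..n} \<le> weak_l2_norm n ys"
    proof -
      have "0 \<le> weak_l2_norm n ys"
        unfolding weak_l2_norm_def
        by (rule cSUP_upper2[OF weak_l2_norm_bdd_above, of 0]) (auto intro: sum_nonneg)
      then show ?thesis
        unfolding L2_set_def form_norm_power2 using dominated_forms_weak[OF dominated] by (intro real_le_lsqrt)
    qed
    finally show ?thesis
      by (simp add: L2_set_def mult_left_mono sum_nonneg)
  qed
  moreover have "(\<lambda>x. x) \<in> bounded_operators dual_hilbert univ_space"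
    using norm_le_dual_norm by (auto simp: bounded_operators_def dual_hilbert_simps)
  ultimately show ?thesis
    unfolding strongly_2_summing_operators_def by (auto simp: dual_hilbert_simps intro!: exI[of _ 1])
qed

text \<open>A Cauchy sequence converges in \<open>F\<close>; its limit \<open>l\<close> inherits the bounds
  \<open>|y(X\<^sub>m - X\<^sub>n)| \<le> e q(y)\<close> as \<open>n\<close> tends to infinity, one \<open>y\<close> at a time.\<close>

lemma complex_hilbert_space_dual_hilbert:
  assumes complete: "\<And>X :: nat \<Rightarrow> 'f. Cauchy X \<Longrightarrow> convergent X"
  shows "complex_hilbert_space dual_hilbert"
proof -
  interpret complex_normed_space dual_hilbert by (rule complex_normed_space_dual_hilbert)
  show ?thesis
  proof unfold_locales
    fix X :: "nat \<Rightarrow> 'f"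
    assume "\<And>n. X n \<in> carrier dual_hilbert"
      and "\<And>e. e > 0 \<Longrightarrow> \<exists>M. \<forall>m\<ge>M. \<forall>n\<ge>M. nrm dual_hilbert (X m \<ominus>\<^bsub>dual_hilbert\<^esub> X n) < e"
    then have X: "\<And>n. X n \<in> form_dual" and C: "\<And>e. e > 0 \<Longrightarrow> \<exists>M. \<forall>m\<ge>M. \<forall>n\<ge>M. dual_norm (X m - X n) < e"
      by (simp_all add: dual_hilbert_simps a_minus_dual_hilbert)
    have "Cauchy X"
    proof (rule CauchyI)
      fix e :: real assume "0 < e"
      then obtain M where M: "\<forall>m\<ge>M. \<forall>n\<ge>M. dual_norm (X m - X n) < e / 2" using C[of "e / 2"] by auto
      have "norm (X m - X n) < e" if "M \<le> m" "M \<le> n" for m n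
        using norm_le_dual_norm[OF diff_form_dual[OF X[of m] X[of n]]] M[rule_format, OF that] by linarith
      then show "\<exists>M. \<forall>m\<ge>M. \<forall>n\<ge>M. norm (X m - X n) < e" by blast
    qed
    then obtain l where l: "X \<longlonglongrightarrow> l" using complete by (auto simp: convergent_def)
    have near: "\<exists>M. \<forall>m\<ge>M. X m - l \<in> form_dual \<and> dual_norm (X m - l) \<le> e" if e: "0 < e" for e
    proof -
      obtain M where M: "\<forall>m\<ge>M. \<forall>n\<ge>M. dual_norm (X m - X n) < e" using C[OF e] by blast
      have "cmod (cdual_apply y (X m - l)) \<le> e * form_norm y" if m: "M \<le> m" for m y
      proof (rule tendsto_upperbound)
        show "(\<lambda>n. cmod (cdual_apply y (X m - X n))) \<longlonglongrightarrow> cmod (cdual_apply y (X m - l))"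
          by (intro tendsto_norm bounded_linear.tendsto[OF bounded_linear_cdual_apply] tendsto_intros l)
        show "\<forall>\<^sub>F n in sequentially. cmod (cdual_apply y (X m - X n)) \<le> e * form_norm y"
        proof (rule eventually_sequentiallyI[of M])
          fix n assume "M \<le> n"
          then have "dual_norm (X m - X n) \<le> e" using M m by (simp add: less_imp_le)
          then have "dual_norm (X m - X n) * form_norm y \<le> e * form_norm y"
            by (rule mult_right_mono[OF _ form_norm_nonneg])
          with cdual_apply_le_dual_norm[OF diff_form_dual[OF X[of m] X[of n]], of y]
          show "cmod (cdual_apply y (X m - X n)) \<le> e * form_norm y" by linarith
        qed
      qed simp
      then have "X m - l \<in> form_dual" "dual_norm (X m - l) \<le> e" if "M \<le> m" for m
        using form_dualI[of e "X m - l"] dual_norm_le[of e "X m - l"] e that by simp_all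
      then show ?thesis by blast
    qed
    obtain m where "X m - l \<in> form_dual" using near[of 1] by auto
    from diff_form_dual[OF X[of m] this] have l_dual: "l \<in> form_dual" by simp
    have "(\<lambda>n. dual_norm (X n - l)) \<longlonglongrightarrow> 0"
    proof (rule LIMSEQ_I)
      fix e :: real assume "0 < e"
      then obtain M where M: "\<forall>m\<ge>M. X m - l \<in> form_dual \<and> dual_norm (X m - l) \<le> e / 2" using near[of "e / 2"] by auto
      have "norm (dual_norm (X n - l) - 0) < e" if "M \<le> n" for n
        using M[rule_format, OF that] dual_norm_nonneg[of "X n - l"] \<open>0 < e\<close> by simp
      then show "\<exists>M. \<forall>n\<ge>M. norm (dual_norm (X n - l) - 0) < e" by blast
    qed
    then show "\<exists>l\<in>carrier dual_hilbert. (\<lambda>n. nrm dual_hilbert (X n \<ominus>\<^bsub>dual_hilbert\<^esub> l)) \<longlonglongrightarrow> 0"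
      using l_dual X by (intro bexI[of _ l]) (simp_all add: dual_hilbert_simps a_minus_dual_hilbert)
  next
    fix x y z assume "x \<in> carrier dual_hilbert" "y \<in> carrier dual_hilbert" "z \<in> carrier dual_hilbert"
    then show "cinner dual_hilbert (x \<oplus>\<^bsub>dual_hilbert\<^esub> y) z = cinner dual_hilbert x z + cinner dual_hilbert y z"
      by (simp add: dual_hilbert_simps dual_ip_add)
  next
    fix x y and c :: complex assume "x \<in> carrier dual_hilbert" "y \<in> carrier dual_hilbert"
    then show "cinner dual_hilbert (c \<odot>\<^bsub>dual_hilbert\<^esub> x) y = c * cinner dual_hilbert x y"
      by (simp add: dual_hilbert_simps dual_ip_scaleC)
  next
    fix x y assume "x \<in> carrier dual_hilbert" "y \<in> carrier dual_hilbert"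
    then show "cinner dual_hilbert x y = cnj (cinner dual_hilbert y x)"
      unfolding dual_hilbert_simps by (rule dual_ip_commute)
  next
    fix x assume "x \<in> carrier dual_hilbert"
    then show "cinner dual_hilbert x x = complex_of_real ((nrm dual_hilbert x)\<^sup>2)"
      by (simp only: dual_hilbert_simps dual_ip_self)
  qed
qed

text \<open>The derivative in \<open>F\<close> is also the derivative for the stronger norm, since the Cauchy estimates
  for \<open>y \<circ> f\<close> with the bound \<open>C q(y)\<close> hold with the same constants for every \<open>y\<close>.\<close>

lemma bounded_holomorphic_into_dual_hilbert:
  fixes f :: "'e::complex_normed_vector \<Rightarrow> 'f"
  assumes U: "open U" and f: "f \<in> holomorphic_maps U univ_space" and C: "0 \<le> C"
    and bound: "\<And>x y. x \<in> U \<Longrightarrow> cmod (cdual_apply y (f x)) \<le> C * form_norm y"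
  shows "f \<in> bounded_holomorphic_maps U dual_hilbert"
proof -
  have f_dual: "f x \<in> form_dual" if "x \<in> U" for x by (rule form_dualI[OF C bound[OF that]])
  have "\<forall>x\<in>U. \<exists>D. (f has_derivative D) (at x) \<and> (\<forall>c h. D (c *\<^sub>C h) = c *\<^sub>C D h)"
    using f unfolding holomorphic_maps_univ_space_iff[OF U] .
  then obtain D where "\<forall>x\<in>U. (f has_derivative D x) (at x) \<and> (\<forall>c h. D x (c *\<^sub>C h) = c *\<^sub>C D x h)"
    unfolding bchoice_iff by blast
  then have D: "\<And>x. x \<in> U \<Longrightarrow> (f has_derivative D x) (at x)"
    "\<And>x c h. x \<in> U \<Longrightarrow> D x (c *\<^sub>C h) = c *\<^sub>C D x h" by blast+
  have "\<exists>D\<in>bounded_operators univ_space dual_hilbert.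
      ((\<lambda>y. nrm dual_hilbert ((f y \<ominus>\<^bsub>dual_hilbert\<^esub> f x) \<ominus>\<^bsub>dual_hilbert\<^esub> D (y - x)) / norm (y - x)) \<longlongrightarrow> 0) (at x within U)"
    if x: "x \<in> U" for x
  proof -
    obtain r where r: "0 < r" and rU: "ball x r \<subseteq> U" using U x open_contains_ball by blast
    have est1: "cmod (cdual_apply y (D x v)) \<le> (4 * C / r * norm v) * form_norm y" for y v
    proof -
      have "cmod (cdual_apply y (D x v)) \<le> 4 * (C * form_norm y) / r * norm v"
        by (rule weak_Cauchy_estimates(1)[OF r D bound]) (use rU in blast)+
      then show ?thesis by (simp add: mult_ac)
    qed
    have est2: "cmod (cdual_apply y (f (x + v) - f x - D x v)) \<le> (32 * C / r\<^sup>2 * (norm v)\<^sup>2) * form_norm y"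
      if "norm v < r / 2" for y v
    proof -
      have "cmod (cdual_apply y (f (x + v) - f x - D x v)) \<le> 32 * (C * form_norm y) / r\<^sup>2 * (norm v)\<^sup>2"
        by (rule weak_Cauchy_estimates(2)[OF r D bound]) (use rU that in blast)+
      then show ?thesis by (simp add: mult_ac)
    qed
    have D_dual: "D x v \<in> form_dual" and D_norm: "dual_norm (D x v) \<le> 4 * C / r * norm v" for v
      using est1 C r by (simp_all add: form_dualI[of "4 * C / r * norm v"] dual_norm_le)
    have rem: "dual_norm (f (x + v) - f x - D x v) \<le> 32 * C / r\<^sup>2 * (norm v)\<^sup>2" if "norm v < r / 2" for v
      by (rule dual_norm_le[OF _ est2[OF that]]) (use C in simp)
    have lin: "linear (D x)" by (rule has_derivative_linear[OF D(1)[OF x]])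
    have "D x \<in> bounded_operators univ_space dual_hilbert"
      using D_dual exI[of "\<lambda>K. \<forall>v. dual_norm (D x v) \<le> K * norm v", OF allI[OF D_norm]]
      by (simp add: bounded_operators_def dual_hilbert_simps linear_add[OF lin] D(2)[OF x])
    moreover have "((\<lambda>y. nrm dual_hilbert ((f y \<ominus>\<^bsub>dual_hilbert\<^esub> f x) \<ominus>\<^bsub>dual_hilbert\<^esub> D x (y - x)) / norm (y - x)) \<longlongrightarrow> 0) (at x within U)"
    proof (rule Lim_null_comparison)
      have "\<forall>\<^sub>F y in at x within U. y \<in> U \<and> y \<noteq> x \<and> dist y x < r / 2"
        using r by (auto simp: eventually_at intro!: exI[of _ "r / 2"])
      then show "\<forall>\<^sub>F y in at x within U. norm (nrm dual_hilbert ((f y \<ominus>\<^bsub>dual_hilbert\<^esub> f x) \<ominus>\<^bsub>dual_hilbert\<^esub> D x (y - x)) / norm (y - x))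
          \<le> 32 * C / r\<^sup>2 * norm (y - x)"
      proof eventually_elim
        case (elim y)
        have "0 \<le> dual_norm (f y - f x - D x (y - x))"
          using elim x by (intro dual_norm_nonneg diff_form_dual f_dual D_dual) auto
        moreover have "dual_norm (f y - f x - D x (y - x)) \<le> 32 * C / r\<^sup>2 * (norm (y - x))\<^sup>2"
          using rem[of "y - x"] elim by (simp add: dist_norm)
        ultimately show ?case
          using elim x by (simp add: dual_hilbert_simps a_minus_dual_hilbert f_dual D_dual diff_form_dual pos_divide_le_eq power2_eq_square)
      qed
      have "((\<lambda>y. 32 * C / r\<^sup>2 * norm (y - x)) \<longlongrightarrow> 32 * C / r\<^sup>2 * norm (x - x)) (at x within U)"
        by (intro tendsto_intros)
      then show "((\<lambda>y. 32 * C / r\<^sup>2 * norm (y - x)) \<longlongrightarrow> 0) (at x within U)" by simp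
    qed
    ultimately show ?thesis by blast
  qed
  then have "f \<in> holomorphic_maps U dual_hilbert"
    using f_dual by (auto simp: holomorphic_maps_def dual_hilbert_simps)
  moreover have "dual_norm (f x) \<le> C" if "x \<in> U" for x
    by (rule dual_norm_le[OF C bound[OF that]])
  ultimately show ?thesis by (auto simp: bounded_holomorphic_maps_def dual_hilbert_simps)
qed

end

theorem corollary5p6:
  fixes U :: "'e::complex_banach set" and f :: "'e \<Rightarrow> 'f::complex_banach"
  assumes "open U"
    and "reflexive_space TYPE('f)"
    and "f \<in> cohen_strongly_2_summing_holomorphic_maps U"
  shows "\<exists>(H :: 'f cinner_space) T g.
    complex_hilbert_space H \<and>
    T \<in> strongly_2_summing_operators H \<and>
    g \<in> bounded_holomorphic_maps U H \<and>
    (\<forall>x\<in>U. f x = T (g x))"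
proof -
  note summing = assms(3)[unfolded cohen_strongly_2_summing_holomorphic_maps_def mem_Collect_eq]
  then have f: "f \<in> holomorphic_maps U univ_space" by (rule conjunct1)
  obtain C where C: "0 \<le> C"
    and "\<exists>s\<in>dominated_forms. \<forall>x\<in>U. \<forall>y. (cmod (cdual_apply y (f x)))\<^sup>2 \<le> C\<^sup>2 * Re (s (y, y))"
    using summing[THEN conjunct2] by (elim exE conjE) (rule that, assumption, rule Pietsch_domination_by_form)
  then obtain s where s: "s \<in> dominated_forms"
    and dom: "\<And>x y. x \<in> U \<Longrightarrow> (cmod (cdual_apply y (f x)))\<^sup>2 \<le> C\<^sup>2 * Re (s (y, y))"
    by blast
  interpret dominated_form s by unfold_locales (rule s)
  have "cmod (cdual_apply y (f x)) \<le> C * form_norm y" if "x \<in> U" for x y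
  proof (rule power2_le_imp_le)
    show "(cmod (cdual_apply y (f x)))\<^sup>2 \<le> (C * form_norm y)\<^sup>2"
      using dom[OF that] by (simp add: power_mult_distrib form_norm_power2)
  qed (simp add: C form_norm_nonneg)
  from bounded_holomorphic_into_dual_hilbert[OF assms(1) f C this]
  have "f \<in> bounded_holomorphic_maps U dual_hilbert" .
  moreover have "complex_hilbert_space dual_hilbert"
    by (rule complex_hilbert_space_dual_hilbert[OF Cauchy_convergent])
  ultimately show ?thesis
    by (intro exI[of _ dual_hilbert] exI[of _ "\<lambda>x. x"] exI[of _ f] conjI strongly_2_summing_inclusion ballI refl)
qed

end
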